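(* The space $JH_\infty$ has the strong diameter two property (and so the norm of $JH_\infty^*$ is octahedral).
   Context: All Banach spaces are real. For a Banach space $X$, $B_X$ and $S_X$ are its closed unit ball and unit sphere and $X^*$ its topological dual; for bounded $A\subseteq X$, $x^*\in X^*$ and $\alpha>0$, the slice is $S(A,x^*,\alpha)=\{x\in A:x^*(x)>\sup_{y\in A}x^*(y)-\alpha\}$. $X$ has the strong diameter two property if every convex combination of slices of $B_X$, i.e. every set $\sum_{i=1}^n\lambda_iS_i$ with $S_i$ slices of $B_X$, $\lambda_i\ge0$, $\sum_i\lambda_i=1$, has diameter $2$. The norm of $X$ is octahedral if for every $\varepsilon>0$ and every finite-dimensional subspace $Y$ of $X$ there is $x\in S_X$ such that $\|\lambda x+y\|\ge(1-\varepsilon)(|\lambda|+\|y\|)$ for every $y\in Y$ and every scalar $\lambda$. The tree: $T=\{\emptyset\}\cup\{(\alpha_1,\ldots,\alpha_k): k\in\mathbb N,\ \alpha_1,\ldots,\alpha_k\in\mathbb N\}$ is the set of finite sequences of natural numbers, partially ordered by initial-segment extension, with $\emptyset$ the least element; $|(\alpha_1,\ldots,\alpha_k)|=k$ and $|\emptyset|=0$. A segment is a non-empty finite interval of $T$, i.e. a set $\{t\in T:s\le t\le s'\}$ with $s\le s'$; it is an $n$-$m$ segment if $|s|=n$ and $|s'|=m$. A finite family $\{S_1,\ldots,S_k\}$ of segments is admissible if there are $n\le m$ such that every $S_i$ is an $n$-$m$ segment and $S_i\cap S_j=\emptyset$ for $i\ne j$. $JH_\infty$ is the completion of the space of finitely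 nonzero functions $x:T\to\mathbb R$ under the norm $\|x\|=\sup\sum_{i=1}^k\left|\sum_{t\in S_i}x(t)\right|$, the supremum being over all admissible families $\{S_1,\ldots,S_k\}$ of segments of $T$. *)

theory Defs
  imports "HOL-Analysis.Analysis" "HOL-Library.Sublist"
begin

section \<open>Slices, the strong diameter two property and octahedral norms\<close>

text \<open>The topological dual of \<open>'a\<close> is the type \<^typ>\<open>'a::real_normed_vector \<Rightarrow>\<^sub>L real\<close> with the
  operator norm.\<close>

definition slice :: "'a::real_normed_vector set \<Rightarrow> ('a \<Rightarrow>\<^sub>L real) \<Rightarrow> real \<Rightarrow> 'a set" where
  "slice A f \<alpha> = {x \<in> A. blinfun_apply f x > (SUP y\<in>A. blinfun_apply f y) - \<alpha>}"

definition is_ball_slice :: "'a::real_normed_vector set \<Rightarrow> bool" where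
  "is_ball_slice S \<longleftrightarrow> (\<exists>f \<alpha>. \<alpha> > 0 \<and> S = slice (cball 0 1) f \<alpha>)"

definition strong_diameter_two :: "'a::real_normed_vector itself \<Rightarrow> bool" where
  "strong_diameter_two _ \<longleftrightarrow>
    (\<forall>(n::nat) (l::nat \<Rightarrow> real) (S::nat \<Rightarrow> 'a set).
      (\<forall>i<n. l i \<ge> 0) \<and> (\<Sum>i<n. l i) = 1 \<and> (\<forall>i<n. is_ball_slice (S i)) \<longrightarrow>
      diameter {(\<Sum>i<n. l i *\<^sub>R x i) | x. \<forall>i<n. x i \<in> S i} = 2)"

definition octahedral_norm :: "'a::real_normed_vector itself \<Rightarrow> bool" where
  "octahedral_norm _ \<longleftrightarrow>
    (\<forall>\<epsilon>>0. \<forall>Y::'a set. subspace Y \<and> (\<exists>B. finite B \<and> span B = Y) \<longrightarrow>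
      (\<exists>x. norm x = 1 \<and>
        (\<forall>y\<in>Y. \<forall>c::real. norm (c *\<^sub>R x + y) \<ge> (1 - \<epsilon>) * (\<bar>c\<bar> + norm y))))"


section \<open>The completion of a normed space\<close>

text \<open>Cauchy sequences modulo null sequences. The \<open>banach\<close> instance together with
  \<open>norm_completion_embed\<close>, \<open>linear_completion_embed\<close> and \<open>closure_range_completion_embed\<close> shows
  that \<open>completion_embed\<close> is an isometric linear embedding with dense range into a Banach space.\<close>

lemma part_equivp_Cauchy_null:
  "part_equivp (\<lambda>x y :: nat \<Rightarrow> 'a::real_normed_vector.
    Cauchy x \<and> Cauchy y \<and> (\<lambda>n. x n - y n) \<longlonglongrightarrow> 0)"
proof (rule part_equivpI)
  show "\<exists>x::nat \<Rightarrow> 'a. Cauchy x \<and> Cauchy x \<and> (\<lambda>n. x n - x n) \<longlonglongrightarrow> 0"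
    by (rule exI[of _ "\<lambda>_. 0"]) (simp add: convergent_Cauchy convergent_const)
  show "symp (\<lambda>x y::nat \<Rightarrow> 'a. Cauchy x \<and> Cauchy y \<and> (\<lambda>n. x n - y n) \<longlonglongrightarrow> 0)"
  proof (rule sympI)
    fix x y :: "nat \<Rightarrow> 'a"
    assume *: "Cauchy x \<and> Cauchy y \<and> (\<lambda>n. x n - y n) \<longlonglongrightarrow> 0"
    then have l: "(\<lambda>n. x n - y n) \<longlonglongrightarrow> 0" by blast
    with * show "Cauchy y \<and> Cauchy x \<and> (\<lambda>n. y n - x n) \<longlonglongrightarrow> 0"
      using tendsto_minus[OF l] by simp
  qed
  show "transp (\<lambda>x y::nat \<Rightarrow> 'a. Cauchy x \<and> Cauchy y \<and> (\<lambda>n. x n - y n) \<longlonglongrightarrow> 0)"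
  proof (rule transpI)
    fix x y z :: "nat \<Rightarrow> 'a"
    assume *: "Cauchy x \<and> Cauchy y \<and> (\<lambda>n. x n - y n) \<longlonglongrightarrow> 0"
      "Cauchy y \<and> Cauchy z \<and> (\<lambda>n. y n - z n) \<longlonglongrightarrow> 0"
    then have l: "(\<lambda>n. x n - y n) \<longlonglongrightarrow> 0" "(\<lambda>n. y n - z n) \<longlonglongrightarrow> 0" by blast+
    with * show "Cauchy x \<and> Cauchy z \<and> (\<lambda>n. x n - z n) \<longlonglongrightarrow> 0"
      using tendsto_add[OF l] by simp
  qed
qed

quotient_type (overloaded) 'a completion =
  "nat \<Rightarrow> 'a::real_normed_vector" / partial:
  "\<lambda>x y. Cauchy x \<and> Cauchy y \<and> (\<lambda>n. x n - y n) \<longlonglongrightarrow> 0"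
  by (rule part_equivp_Cauchy_null)

lemma Cauchy_norm_convergent:
  fixes x :: "nat \<Rightarrow> 'a::real_normed_vector"
  assumes "Cauchy x"
  shows "convergent (\<lambda>n. norm (x n))"
proof -
  have "Cauchy (\<lambda>n. norm (x n))"
    unfolding Cauchy_iff
  proof (intro allI impI)
    fix e :: real
    assume "e > 0"
    then obtain M where "\<forall>m\<ge>M. \<forall>n\<ge>M. norm (x m - x n) < e"
      using assms unfolding Cauchy_iff by blast
    then show "\<exists>M. \<forall>m\<ge>M. \<forall>n\<ge>M. norm (norm (x m) - norm (x n)) < e"
      using norm_triangle_ineq3 order_le_less_trans unfolding real_norm_def by blast
  qed
  then show ?thesis
    by (rule Cauchy_convergent)
qed

lemma Cauchy_scaleR_seq:
  fixes x :: "nat \<Rightarrow> 'a::real_normed_vector"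
  assumes "Cauchy x"
  shows "Cauchy (\<lambda>n. c *\<^sub>R x n)"
  by (rule bounded_linear.Cauchy[OF bounded_linear_scaleR_right assms])

lemma Cauchy_minus_seq:
  fixes x :: "nat \<Rightarrow> 'a::real_normed_vector"
  assumes "Cauchy x"
  shows "Cauchy (\<lambda>n. - x n)"
  using Cauchy_scaleR_seq[OF assms, of "-1"] by simp

lemma Cauchy_add_seq:
  fixes x y :: "nat \<Rightarrow> 'a::real_normed_vector"
  assumes "Cauchy x" "Cauchy y"
  shows "Cauchy (\<lambda>n. x n + y n)"
  unfolding Cauchy_iff
proof (intro allI impI)
  fix e :: real
  assume "e > 0"
  then have "e / 2 > 0" by simp
  with assms obtain M N
    where M: "\<And>m n. m \<ge> M \<Longrightarrow> n \<ge> M \<Longrightarrow> norm (x m - x n) < e / 2"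
      and N: "\<And>m n. m \<ge> N \<Longrightarrow> n \<ge> N \<Longrightarrow> norm (y m - y n) < e / 2"
    unfolding Cauchy_iff by meson
  have "norm (x m + y m - (x n + y n)) < e" if "m \<ge> max M N" "n \<ge> max M N" for m n
  proof -
    have "norm (x m + y m - (x n + y n)) \<le> norm (x m - x n) + norm (y m - y n)"
      using norm_triangle_ineq[of "x m - x n" "y m - y n"] by (simp add: algebra_simps)
    then show ?thesis
      using M[of m n] N[of m n] that by simp
  qed
  then show "\<exists>M. \<forall>m\<ge>M. \<forall>n\<ge>M. norm (x m + y m - (x n + y n)) < e"
    by blast
qed

lemma Cauchy_diff_seq:
  fixes x y :: "nat \<Rightarrow> 'a::real_normed_vector"
  assumes "Cauchy x" "Cauchy y"
  shows "Cauchy (\<lambda>n. x n - y n)"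
  using Cauchy_add_seq[OF assms(1) Cauchy_minus_seq[OF assms(2)]] by simp

lemma Cauchy_const_seq: "Cauchy (\<lambda>_. a :: 'a::real_normed_vector)"
  by (simp add: convergent_Cauchy convergent_const)

instantiation completion :: (real_normed_vector) real_normed_vector
begin

lift_definition zero_completion :: "'a completion" is "\<lambda>_. 0"
  by (simp add: Cauchy_const_seq)

lift_definition plus_completion :: "'a completion \<Rightarrow> 'a completion \<Rightarrow> 'a completion"
  is "\<lambda>x y n. x n + y n"
proof (clarify, intro conjI)
  fix x x' y y' :: "nat \<Rightarrow> 'a"
  assume c: "Cauchy x" "Cauchy x'" "Cauchy y" "Cauchy y'"
    and l: "(\<lambda>n. x n - x' n) \<longlonglongrightarrow> 0" "(\<lambda>n. y n - y' n) \<longlonglongrightarrow> 0"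
  show "Cauchy (\<lambda>n. x n + y n)" "Cauchy (\<lambda>n. x' n + y' n)"
    using c by (simp_all add: Cauchy_add_seq)
  show "(\<lambda>n. x n + y n - (x' n + y' n)) \<longlonglongrightarrow> 0"
    using tendsto_add[OF l] by (simp add: algebra_simps)
qed

lift_definition uminus_completion :: "'a completion \<Rightarrow> 'a completion"
  is "\<lambda>x n. - x n"
proof (clarify, intro conjI)
  fix x x' :: "nat \<Rightarrow> 'a"
  assume c: "Cauchy x" "Cauchy x'" and l: "(\<lambda>n. x n - x' n) \<longlonglongrightarrow> 0"
  show "Cauchy (\<lambda>n. - x n)" "Cauchy (\<lambda>n. - x' n)"
    using c by (simp_all add: Cauchy_minus_seq)
  show "(\<lambda>n. - x n - - x' n) \<longlonglongrightarrow> 0"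
    using tendsto_minus[OF l] by simp
qed

lift_definition minus_completion :: "'a completion \<Rightarrow> 'a completion \<Rightarrow> 'a completion"
  is "\<lambda>x y n. x n - y n"
proof (clarify, intro conjI)
  fix x x' y y' :: "nat \<Rightarrow> 'a"
  assume c: "Cauchy x" "Cauchy x'" "Cauchy y" "Cauchy y'"
    and l: "(\<lambda>n. x n - x' n) \<longlonglongrightarrow> 0" "(\<lambda>n. y n - y' n) \<longlonglongrightarrow> 0"
  show "Cauchy (\<lambda>n. x n - y n)" "Cauchy (\<lambda>n. x' n - y' n)"
    using c by (simp_all add: Cauchy_diff_seq)
  show "(\<lambda>n. x n - y n - (x' n - y' n)) \<longlonglongrightarrow> 0"
    using tendsto_diff[OF l] by (simp add: algebra_simps)
qed

lift_definition scaleR_completion :: "real \<Rightarrow> 'a completion \<Rightarrow> 'a completion"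
  is "\<lambda>c x n. c *\<^sub>R x n"
proof (clarify, intro conjI)
  fix c :: real and x x' :: "nat \<Rightarrow> 'a"
  assume c: "Cauchy x" "Cauchy x'" and l: "(\<lambda>n. x n - x' n) \<longlonglongrightarrow> 0"
  show "Cauchy (\<lambda>n. c *\<^sub>R x n)" "Cauchy (\<lambda>n. c *\<^sub>R x' n)"
    using c by (simp_all add: Cauchy_scaleR_seq)
  show "(\<lambda>n. c *\<^sub>R x n - c *\<^sub>R x' n) \<longlonglongrightarrow> 0"
    using tendsto_scaleR[OF tendsto_const[of c] l] by (simp add: algebra_simps)
qed

lift_definition norm_completion :: "'a completion \<Rightarrow> real"
  is "\<lambda>x. lim (\<lambda>n. norm (x n))"
proof (clarify)
  fix x x' :: "nat \<Rightarrow> 'a"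
  assume c: "Cauchy x" "Cauchy x'" and l: "(\<lambda>n. x n - x' n) \<longlonglongrightarrow> 0"
  have 1: "(\<lambda>n. norm (x' n)) \<longlonglongrightarrow> lim (\<lambda>n. norm (x' n))"
    using Cauchy_norm_convergent[OF c(2)] by (simp add: convergent_LIMSEQ_iff)
  have "(\<lambda>n. norm (x n) - norm (x' n)) \<longlonglongrightarrow> 0"
  proof (rule Lim_null_comparison)
    show "\<forall>\<^sub>F n in sequentially. norm (norm (x n) - norm (x' n)) \<le> norm (x n - x' n)"
      by (simp add: norm_triangle_ineq3)
    show "(\<lambda>n. norm (x n - x' n)) \<longlonglongrightarrow> 0"
      using l by (simp add: tendsto_norm_zero)
  qed
  from tendsto_add[OF this 1] show "lim (\<lambda>n. norm (x n)) = lim (\<lambda>n. norm (x' n))"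
    by (simp add: limI)
qed

definition sgn_completion :: "'a completion \<Rightarrow> 'a completion"
  where "sgn_completion x = inverse (norm x) *\<^sub>R x"

definition dist_completion :: "'a completion \<Rightarrow> 'a completion \<Rightarrow> real"
  where "dist_completion x y = norm (x - y)"

definition uniformity_completion :: "('a completion \<times> 'a completion) filter"
  where "uniformity_completion = (INF e\<in>{0 <..}. principal {(x, y). dist x y < e})"

definition open_completion :: "'a completion set \<Rightarrow> bool"
  where "open_completion U \<longleftrightarrow> (\<forall>x\<in>U. \<forall>\<^sub>F (x', y) in uniformity. x' = x \<longrightarrow> y \<in> U)"

instance
proof
  have lim_norm: "(\<lambda>n. norm (x n)) \<longlonglongrightarrow> lim (\<lambda>n. norm (x n))" if "Cauchy x" for x :: "nat \<Rightarrow> 'a"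
    using Cauchy_norm_convergent[OF that] by (simp add: convergent_LIMSEQ_iff)
  fix x y z :: "'a completion" and a b :: real
  show "x + y + z = x + (y + z)"
    by transfer (simp add: Cauchy_add_seq add.assoc)
  show "x + y = y + x"
    by transfer (simp add: Cauchy_add_seq add.commute)
  show "0 + x = x"
    by transfer simp
  show "- x + x = 0"
    by transfer (simp add: Cauchy_const_seq)
  show "x - y = x + - y"
    by transfer (simp add: Cauchy_diff_seq)
  show "a *\<^sub>R (x + y) = a *\<^sub>R x + a *\<^sub>R y"
    by transfer (simp add: scaleR_add_right Cauchy_add_seq Cauchy_scaleR_seq)
  show "(a + b) *\<^sub>R x = a *\<^sub>R x + b *\<^sub>R x"
    by transfer (simp add: scaleR_add_left Cauchy_add_seq Cauchy_scaleR_seq)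
  show "a *\<^sub>R b *\<^sub>R x = (a * b) *\<^sub>R x"
    by transfer (simp add: Cauchy_scaleR_seq)
  show "1 *\<^sub>R x = x"
    by transfer simp
  show "sgn x = inverse (norm x) *\<^sub>R x"
    by (rule sgn_completion_def)
  show "dist x y = norm (x - y)"
    by (rule dist_completion_def)
  show "uniformity = (INF e\<in>{0 <..}. principal {(x, y::'a completion). dist x y < e})"
    by (rule uniformity_completion_def)
  show "open U \<longleftrightarrow> (\<forall>x\<in>U. \<forall>\<^sub>F (x', y) in uniformity. x' = x \<longrightarrow> y \<in> U)"
    for U :: "'a completion set"
    by (rule open_completion_def)
  show "norm x = 0 \<longleftrightarrow> x = 0"
  proof transfer
    fix x :: "nat \<Rightarrow> 'a"
    assume "Cauchy x \<and> Cauchy x \<and> (\<lambda>n. x n - x n) \<longlonglongrightarrow> 0"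
    then have c: "Cauchy x" by simp
    have "lim (\<lambda>n. norm (x n)) = 0 \<longleftrightarrow> (\<lambda>n. norm (x n)) \<longlonglongrightarrow> 0"
      using lim_norm[OF c] limI by metis
    then show "lim (\<lambda>n. norm (x n)) = 0 \<longleftrightarrow>
        Cauchy x \<and> Cauchy (\<lambda>_. 0::'a) \<and> (\<lambda>n. x n - 0) \<longlonglongrightarrow> 0"
      using c by (simp add: Cauchy_const_seq tendsto_norm_zero_iff)
  qed
  show "norm (x + y) \<le> norm x + norm y"
  proof transfer
    fix x y :: "nat \<Rightarrow> 'a"
    assume "Cauchy x \<and> Cauchy x \<and> (\<lambda>n. x n - x n) \<longlonglongrightarrow> 0"
      and "Cauchy y \<and> Cauchy y \<and> (\<lambda>n. y n - y n) \<longlonglongrightarrow> 0"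
    then have c: "Cauchy x" "Cauchy y" by auto
    show "lim (\<lambda>n. norm (x n + y n)) \<le> lim (\<lambda>n. norm (x n)) + lim (\<lambda>n. norm (y n))"
      by (rule LIMSEQ_le[OF lim_norm[OF Cauchy_add_seq[OF c]]
            tendsto_add[OF lim_norm[OF c(1)] lim_norm[OF c(2)]]])
         (auto intro: norm_triangle_ineq)
  qed
  show "norm (a *\<^sub>R x) = \<bar>a\<bar> * norm x"
  proof transfer
    fix a :: real and x :: "nat \<Rightarrow> 'a"
    assume "Cauchy x \<and> Cauchy x \<and> (\<lambda>n. x n - x n) \<longlonglongrightarrow> 0"
    then have c: "Cauchy x" by auto
    from tendsto_mult[OF tendsto_const[of "\<bar>a\<bar>"] lim_norm[OF c]]
    show "lim (\<lambda>n. norm (a *\<^sub>R x n)) = \<bar>a\<bar> * lim (\<lambda>n. norm (x n))"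
      by (simp add: limI)
  qed
qed

end

lift_definition completion_embed :: "'a::real_normed_vector \<Rightarrow> 'a completion" is "\<lambda>a _. a"
  by (simp add: Cauchy_const_seq)

lemma norm_completion_embed: "norm (completion_embed a) = norm a"
  by transfer (simp add: limI)

lemma linear_completion_embed: "linear completion_embed"
proof (rule linearI)
  show "completion_embed (a + b) = completion_embed a + completion_embed b" for a b :: 'a
    by transfer (simp add: Cauchy_const_seq)
  show "completion_embed (c *\<^sub>R a) = c *\<^sub>R completion_embed a" for c and a :: 'a
    by transfer (simp add: Cauchy_const_seq)
qed

lemma completion_embed_dense:
  fixes x :: "'a::real_normed_vector completion"
  assumes "e > 0"
  shows "\<exists>a. norm (x - completion_embed a) < e"
  using assms
proof transfer
  fix e :: real and x :: "nat \<Rightarrow> 'a"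
  assume e: "e > 0" and "Cauchy x \<and> Cauchy x \<and> (\<lambda>n. x n - x n) \<longlonglongrightarrow> 0"
  then have c: "Cauchy x" by simp
  from c e obtain M where M: "\<And>m n. m \<ge> M \<Longrightarrow> n \<ge> M \<Longrightarrow> norm (x m - x n) < e / 2"
    unfolding Cauchy_iff by (meson half_gt_zero)
  have "(\<lambda>n. norm (x n - x M)) \<longlonglongrightarrow> lim (\<lambda>n. norm (x n - x M))"
    using Cauchy_norm_convergent[OF Cauchy_diff_seq[OF c Cauchy_const_seq]]
    by (simp add: convergent_LIMSEQ_iff)
  then have "lim (\<lambda>n. norm (x n - x M)) \<le> e / 2"
    by (rule LIMSEQ_le_const2) (use M in \<open>auto intro!: exI[of _ M] less_imp_le\<close>)
  also have "\<dots> < e"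
    using e by simp
  finally show "\<exists>a. lim (\<lambda>n. norm (x n - a)) < e"
    by blast
qed

lemma closure_range_completion_embed: "closure (range completion_embed) = UNIV"
proof -
  have "x \<in> closure (range completion_embed)" for x :: "'a completion"
    unfolding closure_approachable dist_norm
    using completion_embed_dense[of _ x] by (auto simp: norm_minus_commute)
  then show ?thesis
    by blast
qed

lemma completion_embed_Cauchy_tendsto:
  fixes a :: "nat \<Rightarrow> 'a::real_normed_vector"
  assumes c: "Cauchy a"
  shows "\<exists>y. \<forall>e>0. \<exists>N. \<forall>n\<ge>N. norm (completion_embed (a n) - y) \<le> e"
proof (intro exI[of _ "abs_completion a"] allI impI)
  fix e :: real
  assume "e > 0"
  with c obtain M where M: "\<And>m n. m \<ge> M \<Longrightarrow> n \<ge> M \<Longrightarrow> norm (a m - a n) < e"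
    unfolding Cauchy_iff by meson
  have "norm (completion_embed (a n) - abs_completion a) \<le> e" if "n \<ge> M" for n
  proof -
    have "completion_embed (a n) - abs_completion a = abs_completion (\<lambda>m. a n - a m)"
      using c by (simp add: completion_embed.abs_eq minus_completion.abs_eq eq_onp_def Cauchy_const_seq)
    then have "norm (completion_embed (a n) - abs_completion a) = lim (\<lambda>m. norm (a n - a m))"
      using c by (simp add: norm_completion.abs_eq Cauchy_diff_seq Cauchy_const_seq)
    moreover have "(\<lambda>m. norm (a n - a m)) \<longlonglongrightarrow> lim (\<lambda>m. norm (a n - a m))"
      using Cauchy_norm_convergent[OF Cauchy_diff_seq[OF Cauchy_const_seq c]]
      by (simp add: convergent_LIMSEQ_iff)
    then have "lim (\<lambda>m. norm (a n - a m)) \<le> e"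
      by (rule LIMSEQ_le_const2) (use M that in \<open>auto intro!: exI[of _ M] less_imp_le\<close>)
    ultimately show ?thesis
      by simp
  qed
  then show "\<exists>N. \<forall>n\<ge>N. norm (completion_embed (a n) - abs_completion a) \<le> e"
    by blast
qed

instance completion :: (real_normed_vector) banach
proof
  fix X :: "nat \<Rightarrow> 'a completion"
  assume X: "Cauchy X"
  have "\<forall>n. \<exists>b. norm (X n - completion_embed b) < inverse (real (Suc n))"
    by (intro allI completion_embed_dense) simp
  then obtain a where a: "\<And>n. norm (X n - completion_embed (a n)) < inverse (real (Suc n))"
    by metis
  have "(\<lambda>n. X n - completion_embed (a n)) \<longlonglongrightarrow> 0"
    by (rule Lim_null_comparison[OF always_eventually LIMSEQ_inverse_real_of_nat])
       (intro allI less_imp_le a)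
  from tendsto_minus[OF this] have d: "(\<lambda>n. completion_embed (a n) - X n) \<longlonglongrightarrow> 0"
    by simp
  then have "Cauchy (\<lambda>n. (completion_embed (a n) - X n) + X n)"
    by (intro Cauchy_add_seq X LIMSEQ_imp_Cauchy)
  then have "Cauchy (\<lambda>n. completion_embed (a n))"
    by simp
  then have "Cauchy a"
    unfolding Cauchy_iff by (simp add: linear_diff[OF linear_completion_embed, symmetric] norm_completion_embed)
  from completion_embed_Cauchy_tendsto[OF this] obtain y
    where y: "\<forall>e>0. \<exists>N. \<forall>n\<ge>N. norm (completion_embed (a n) - y) \<le> e"
    by blast
  have "(\<lambda>n. completion_embed (a n)) \<longlonglongrightarrow> y"
    unfolding LIMSEQ_iff
  proof (intro allI impI)
    fix r :: real
    assume r: "r > 0"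
    with y obtain N where "\<forall>n\<ge>N. norm (completion_embed (a n) - y) \<le> r / 2"
      by (meson half_gt_zero)
    with r show "\<exists>N. \<forall>n\<ge>N. norm (completion_embed (a n) - y) < r"
      by (intro exI[of _ N]) force
  qed
  from tendsto_diff[OF this d] show "convergent X"
    by (auto simp: convergent_def)
qed


section \<open>The tree and the space $JH_\infty$\<close>

text \<open>Nodes of the tree are elements of \<^typ>\<open>nat list\<close>, ordered by \<^const>\<open>prefix\<close>.\<close>

definition segment :: "nat list \<Rightarrow> nat list \<Rightarrow> nat list set" where
  "segment s s' = {t. prefix s t \<and> prefix t s'}"

definition is_nm_segment :: "nat \<Rightarrow> nat \<Rightarrow> nat list set \<Rightarrow> bool" where
  "is_nm_segment n m S \<longleftrightarrow>
    (\<exists>s s'. prefix s s' \<and> length s = n \<and> length s' = m \<and> S = segment s s')"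

text \<open>As segments are non-empty, the members of an admissible family are distinct, so the family
  can be given as a set. The empty family is allowed; it contributes \<open>0\<close> to the supremum below.\<close>

definition admissible :: "nat list set set \<Rightarrow> bool" where
  "admissible F \<longleftrightarrow> finite F \<and> (\<exists>n m. n \<le> m \<and> (\<forall>S\<in>F. is_nm_segment n m S)) \<and> pairwise disjnt F"

definition family_sum :: "(nat list \<Rightarrow> real) \<Rightarrow> nat list set set \<Rightarrow> real" where
  "family_sum x F = (\<Sum>S\<in>F. \<bar>\<Sum>t\<in>S. x t\<bar>)"

typedef tree_fun = "{x :: nat list \<Rightarrow> real. finite {t. x t \<noteq> 0}}"
  by (rule exI[of _ "\<lambda>_. 0"]) simp

setup_lifting type_definition_tree_fun

lemma finite_segment: "finite (segment s s')"
  by (rule finite_subset[of _ "set (prefixes s')"]) (auto simp: segment_def in_set_prefixes)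

lemma admissible_finite: "admissible F \<Longrightarrow> S \<in> F \<Longrightarrow> finite S"
  by (auto simp: admissible_def is_nm_segment_def finite_segment dest!: bspec)

lemma admissible_empty: "admissible {}"
  unfolding admissible_def by (intro conjI exI[of _ 0]) simp_all

lemma family_sum_le:
  assumes "finite {t. x t \<noteq> 0}" "admissible F"
  shows "family_sum x F \<le> (\<Sum>t\<in>{t. x t \<noteq> 0}. \<bar>x t\<bar>)"
proof -
  have fin: "finite F" "\<And>S. S \<in> F \<Longrightarrow> finite S"
    using assms(2) admissible_finite[OF assms(2)] by (auto simp: admissible_def)
  have "family_sum x F \<le> (\<Sum>S\<in>F. \<Sum>t\<in>S. \<bar>x t\<bar>)"
    unfolding family_sum_def by (intro sum_mono sum_abs)
  also have "\<dots> = (\<Sum>t\<in>\<Union>F. \<bar>x t\<bar>)"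
    using assms(2) fin
    by (subst sum.Union_disjoint) (auto simp: admissible_def pairwise_def disjnt_def)
  also have "\<dots> = (\<Sum>t\<in>\<Union>F \<inter> {t. x t \<noteq> 0}. \<bar>x t\<bar>)"
    by (intro sum.mono_neutral_right) (auto simp: fin)
  also have "\<dots> \<le> (\<Sum>t\<in>{t. x t \<noteq> 0}. \<bar>x t\<bar>)"
    by (intro sum_mono2 assms(1)) auto
  finally show ?thesis .
qed

lemma bdd_above_family_sum:
  "finite {t. x t \<noteq> 0} \<Longrightarrow> bdd_above (family_sum x ` Collect admissible)"
  by (rule bdd_aboveI2[of _ _ "\<Sum>t\<in>{t. x t \<noteq> 0}. \<bar>x t\<bar>"]) (simp add: family_sum_le)

instantiation tree_fun :: real_normed_vector
begin

lift_definition zero_tree_fun :: tree_fun is "\<lambda>_. 0"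
  by simp

lift_definition plus_tree_fun :: "tree_fun \<Rightarrow> tree_fun \<Rightarrow> tree_fun" is "\<lambda>x y t. x t + y t"
  subgoal for x y
    by (rule finite_subset[of _ "{t. x t \<noteq> 0} \<union> {t. y t \<noteq> 0}"]) auto
  done

lift_definition minus_tree_fun :: "tree_fun \<Rightarrow> tree_fun \<Rightarrow> tree_fun" is "\<lambda>x y t. x t - y t"
  subgoal for x y
    by (rule finite_subset[of _ "{t. x t \<noteq> 0} \<union> {t. y t \<noteq> 0}"]) auto
  done

lift_definition uminus_tree_fun :: "tree_fun \<Rightarrow> tree_fun" is "\<lambda>x t. - x t"
  by simp

lift_definition scaleR_tree_fun :: "real \<Rightarrow> tree_fun \<Rightarrow> tree_fun" is "\<lambda>c x t. c * x t"
  by simp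

lift_definition norm_tree_fun :: "tree_fun \<Rightarrow> real"
  is "\<lambda>x. SUP F\<in>Collect admissible. family_sum x F" .

definition sgn_tree_fun :: "tree_fun \<Rightarrow> tree_fun"
  where "sgn_tree_fun x = inverse (norm x) *\<^sub>R x"

definition dist_tree_fun :: "tree_fun \<Rightarrow> tree_fun \<Rightarrow> real"
  where "dist_tree_fun x y = norm (x - y)"

definition uniformity_tree_fun :: "(tree_fun \<times> tree_fun) filter"
  where "uniformity_tree_fun = (INF e\<in>{0 <..}. principal {(x, y). dist x y < e})"

definition open_tree_fun :: "tree_fun set \<Rightarrow> bool"
  where "open_tree_fun U \<longleftrightarrow> (\<forall>x\<in>U. \<forall>\<^sub>F (x', y) in uniformity. x' = x \<longrightarrow> y \<in> U)"

instance
proof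
  fix x y z :: tree_fun and a b :: real
  show "x + y + z = x + (y + z)" by transfer (simp add: add.assoc)
  show "x + y = y + x" by transfer (simp add: add.commute)
  show "0 + x = x" by transfer simp
  show "- x + x = 0" by transfer simp
  show "x - y = x + - y" by transfer simp
  show "a *\<^sub>R (x + y) = a *\<^sub>R x + a *\<^sub>R y" by transfer (simp add: algebra_simps)
  show "(a + b) *\<^sub>R x = a *\<^sub>R x + b *\<^sub>R x" by transfer (simp add: algebra_simps)
  show "a *\<^sub>R b *\<^sub>R x = (a * b) *\<^sub>R x" by transfer (simp add: mult.assoc)
  show "1 *\<^sub>R x = x" by transfer simp
  show "sgn x = inverse (norm x) *\<^sub>R x"
    by (rule sgn_tree_fun_def)
  show "dist x y = norm (x - y)"
    by (rule dist_tree_fun_def)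
  show "uniformity = (INF e\<in>{0 <..}. principal {(x, y::tree_fun). dist x y < e})"
    by (rule uniformity_tree_fun_def)
  show "open U \<longleftrightarrow> (\<forall>x\<in>U. \<forall>\<^sub>F (x', y) in uniformity. x' = x \<longrightarrow> y \<in> U)" for U :: "tree_fun set"
    by (rule open_tree_fun_def)
  have ne: "Collect admissible \<noteq> {}"
    using admissible_empty by blast
  show "norm x = 0 \<longleftrightarrow> x = 0"
  proof transfer
    fix x :: "nat list \<Rightarrow> real"
    assume x: "finite {t. x t \<noteq> 0}"
    show "(SUP F\<in>Collect admissible. family_sum x F) = 0 \<longleftrightarrow> x = (\<lambda>_. 0)"
    proof
      assume 0: "(SUP F\<in>Collect admissible. family_sum x F) = 0"
      have "x t = 0" for t
      proof -
        have seg: "segment t t = {t}"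
          by (auto simp: segment_def)
        then have "is_nm_segment (length t) (length t) {t}"
          unfolding is_nm_segment_def by blast
        then have "admissible {{t}}"
          unfolding admissible_def by auto
        then have "family_sum x {{t}} \<le> (SUP F\<in>Collect admissible. family_sum x F)"
          by (intro cSUP_upper bdd_above_family_sum[OF x]) simp
        with 0 show ?thesis
          by (simp add: family_sum_def)
      qed
      then show "x = (\<lambda>_. 0)" by blast
    next
      assume "x = (\<lambda>_. 0)"
      then show "(SUP F\<in>Collect admissible. family_sum x F) = 0"
        using ne by (simp add: family_sum_def)
    qed
  qed
  show "norm (x + y) \<le> norm x + norm y"
  proof transfer
    fix x y :: "nat list \<Rightarrow> real"
    assume x: "finite {t. x t \<noteq> 0}" and y: "finite {t. y t \<noteq> 0}"
    show "(SUP F\<in>Collect admissible. family_sum (\<lambda>t. x t + y t) F)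
        \<le> (SUP F\<in>Collect admissible. family_sum x F) + (SUP F\<in>Collect admissible. family_sum y F)"
    proof (rule cSUP_least[OF ne])
      fix F
      assume F: "F \<in> Collect admissible"
      have "family_sum (\<lambda>t. x t + y t) F \<le> family_sum x F + family_sum y F"
        unfolding family_sum_def sum.distrib[symmetric]
        by (intro sum_mono) (simp add: sum.distrib abs_triangle_ineq)
      also have "\<dots> \<le> (SUP F\<in>Collect admissible. family_sum x F)
          + (SUP F\<in>Collect admissible. family_sum y F)"
        by (intro add_mono cSUP_upper F bdd_above_family_sum x y)
      finally show "family_sum (\<lambda>t. x t + y t) F \<le> \<dots>" .
    qed
  qed
  show "norm (a *\<^sub>R x) = \<bar>a\<bar> * norm x"
  proof transfer
    fix a :: real and x :: "nat list \<Rightarrow> real"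
    assume x: "finite {t. x t \<noteq> 0}"
    have "family_sum (\<lambda>t. a * x t) F = \<bar>a\<bar> * family_sum x F" for F
      by (simp add: family_sum_def sum_distrib_left[symmetric] abs_mult)
    moreover have "\<bar>a\<bar> * (SUP F\<in>Collect admissible. family_sum x F)
        = (SUP F\<in>Collect admissible. \<bar>a\<bar> * family_sum x F)"
      by (rule continuous_at_Sup_mono
            [of "\<lambda>u. \<bar>a\<bar> * u" "family_sum x ` Collect admissible", unfolded image_image])
         (use ne bdd_above_family_sum[OF x] in
           \<open>auto simp: mono_def mult_left_mono intro!: continuous_intros\<close>)
    ultimately show "(SUP F\<in>Collect admissible. family_sum (\<lambda>t. a * x t) F)
        = \<bar>a\<bar> * (SUP F\<in>Collect admissible. family_sum x F)"
      by simp
  qed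
qed

end

type_synonym JH_infty = "tree_fun completion"

end

theory Submission
  imports Defs
begin

text \<open>The idea is that the unit ball of \<open>JH\<^sub>\<infinity>\<close> contains many directions \<open>z\<close> along which one can
  move freely. Let \<open>x\<^sub>1, \<dots>, x\<^sub>n\<close> be vectors of the ball supported on the levels up to \<open>|w|\<close>, and
  let \<open>z\<close> be an average with signs of \<open>2k\<close> unit vectors at children of the node \<open>w\<close>. An admissible
  family that starts below level \<open>|w|\<close> does not see the \<open>x\<^sub>i\<close>, and one that starts at or above it
  reaches at most one child of \<open>w\<close>, because all the children are reached through \<open>w\<close>; hence
  \<open>\<parallel>z\<parallel> = 1\<close> and \<open>\<parallel>x\<^sub>i \<plusminus> z\<parallel> \<le> 1 + 1/(2k)\<close>. By the pigeonhole principle the children can be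
  chosen among infinitely many on which finitely many given functionals are nearly constant; if the
  signs add up to \<open>0\<close>, these functionals are nearly \<open>0\<close> at \<open>z\<close>. So the \<open>x\<^sub>i \<plusminus> z\<close> stay, up to
  scaling, in given slices, and convex combinations of them with the same weights differ by \<open>2z\<close>.
  For the dual, the functional \<open>f\<close> that reads off the signed sum over the children has norm \<open>1 = f z\<close>
  and vanishes at the \<open>x\<^sub>i\<close>. If \<open>g\<close> nearly attains its norm at \<open>x\<^sub>i\<close>, then testing \<open>c f + g\<close> at
  \<open>x\<^sub>i + z\<close> gives almost \<open>c + \<parallel>g\<parallel>\<close>.\<close>

section \<open>Free directions\<close>

text \<open>One property serves both conclusions: slices need \<open>z\<close> with the bounds on
  \<open>A\<close> and \<open>G\<close>, and the dual norm needs in addition the functional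
  \<open>f\<close> that norms \<open>z\<close> and nearly vanishes on \<open>A\<close>.\<close>

definition free_directions :: "'a::real_normed_vector itself \<Rightarrow> bool" where
  "free_directions _ \<longleftrightarrow>
    (\<forall>(A::'a set) (G::('a \<Rightarrow>\<^sub>L real) set) \<epsilon>.
      finite A \<and> A \<subseteq> cball 0 1 \<and> finite G \<and> \<epsilon> > 0 \<longrightarrow>
      (\<exists>z f. norm z = 1 \<and> norm f = 1 \<and> blinfun_apply f z = 1 \<and>
        (\<forall>x\<in>A. \<bar>blinfun_apply f x\<bar> \<le> \<epsilon> \<and> norm (x + z) \<le> 1 + \<epsilon> \<and> norm (x - z) \<le> 1 + \<epsilon>) \<and>
        (\<forall>g\<in>G. \<bar>blinfun_apply g z\<bar> \<le> \<epsilon>)))"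

lemma free_directionsE:
  fixes A :: "'a::real_normed_vector set" and G :: "('a \<Rightarrow>\<^sub>L real) set"
  assumes "free_directions TYPE('a)" "finite A" "A \<subseteq> cball 0 1" "finite G" "\<epsilon> > 0"
  obtains z f where "norm z = 1" "norm f = 1" "blinfun_apply f z = 1"
    "\<And>x. x \<in> A \<Longrightarrow> \<bar>blinfun_apply f x\<bar> \<le> \<epsilon>"
    "\<And>x. x \<in> A \<Longrightarrow> norm (x + z) \<le> 1 + \<epsilon>" "\<And>x. x \<in> A \<Longrightarrow> norm (x - z) \<le> 1 + \<epsilon>"
    "\<And>g. g \<in> G \<Longrightarrow> \<bar>blinfun_apply g z\<bar> \<le> \<epsilon>"
proof -
  have "\<exists>z f. norm z = 1 \<and> norm f = 1 \<and> blinfun_apply f z = 1 \<and>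
      (\<forall>x\<in>A. \<bar>blinfun_apply f x\<bar> \<le> \<epsilon> \<and> norm (x + z) \<le> 1 + \<epsilon> \<and> norm (x - z) \<le> 1 + \<epsilon>) \<and>
      (\<forall>g\<in>G. \<bar>blinfun_apply g z\<bar> \<le> \<epsilon>)"
    using assms unfolding free_directions_def by blast
  then show thesis
    using that by blast
qed

section \<open>Slices of the unit ball and the strong diameter two property\<close>

lemma abs_blinfun_le_norm:
  fixes f :: "'a::real_normed_vector \<Rightarrow>\<^sub>L real"
  shows "\<bar>blinfun_apply f x\<bar> \<le> norm f * norm x"
  using norm_blinfun[of f x] by simp

lemma bdd_above_blinfun_cball:
  fixes f :: "'a::real_normed_vector \<Rightarrow>\<^sub>L real"
  shows "bdd_above (blinfun_apply f ` cball 0 1)"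
proof (rule bdd_aboveI2)
  fix x :: 'a
  assume "x \<in> cball 0 1"
  then have "norm f * norm x \<le> norm f * 1"
    by (intro mult_left_mono) auto
  then show "blinfun_apply f x \<le> norm f"
    using abs_blinfun_le_norm[of f x] by linarith
qed

lemma ball_slice_nonempty:
  fixes S :: "'a::real_normed_vector set"
  assumes "is_ball_slice S"
  shows "S \<noteq> {}"
proof -
  from assms obtain f \<alpha> where \<alpha>: "\<alpha> > 0" and S: "S = slice (cball 0 1) f \<alpha>"
    unfolding is_ball_slice_def by blast
  have "(SUP y\<in>cball 0 1. blinfun_apply f y) - \<alpha> < (SUP y\<in>cball 0 1. blinfun_apply f y)"
    using \<alpha> by simp
  then obtain x where "x \<in> cball 0 1" "(SUP y\<in>cball 0 1. blinfun_apply f y) - \<alpha> < blinfun_apply f x"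
    by (subst (asm) less_cSUP_iff) (auto simp: bdd_above_blinfun_cball)
  then show ?thesis
    unfolding S slice_def by blast
qed

text \<open>Only the threshold of a slice matters later; what remains is a strict inequality, which
  survives small perturbations.\<close>

lemma ball_slice_eq:
  fixes S :: "'a::real_normed_vector set"
  assumes "is_ball_slice S"
  obtains f :: "'a \<Rightarrow>\<^sub>L real" and b where "S = {x. norm x \<le> 1 \<and> b < blinfun_apply f x}"
proof -
  from assms obtain f \<alpha> where "S = slice (cball 0 1) f \<alpha>"
    unfolding is_ball_slice_def by blast
  then have "S = {x. norm x \<le> 1 \<and> (SUP y\<in>cball 0 1. blinfun_apply f y) - \<alpha> < blinfun_apply f x}"
    unfolding slice_def by auto
  then show thesis
    by (rule that)
qed

text \<open>A point of each slice is moved by \<open>z\<close> and by \<open>- z\<close> and scaled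
  back into the ball by \<open>1 + \<epsilon>\<close>. All slices share the same \<open>z\<close>,
  so the displacement survives convex combination.\<close>

lemma strong_diameter_two_if_free_directions:
  assumes free: "free_directions TYPE('a::real_normed_vector)"
  shows "strong_diameter_two TYPE('a)"
  unfolding strong_diameter_two_def
proof (intro allI impI, elim conjE)
  fix n :: nat and l :: "nat \<Rightarrow> real" and S :: "nat \<Rightarrow> 'a set"
  assume l0: "\<forall>i<n. l i \<ge> 0" and l1: "(\<Sum>i<n. l i) = 1" and sl: "\<forall>i<n. is_ball_slice (S i)"
  define C where "C = {(\<Sum>i<n. l i *\<^sub>R x i) | x. \<forall>i<n. x i \<in> S i}"
  have "\<forall>i. \<exists>(f :: 'a \<Rightarrow>\<^sub>L real) b. i < n \<longrightarrow> S i = {x. norm x \<le> 1 \<and> b < blinfun_apply f x}"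
    using sl ball_slice_eq by metis
  then obtain f :: "nat \<Rightarrow> 'a \<Rightarrow>\<^sub>L real" and b
    where S: "\<And>i. i < n \<Longrightarrow> S i = {x. norm x \<le> 1 \<and> b i < blinfun_apply (f i) x}"
    by metis
  have "\<forall>i. \<exists>x. i < n \<longrightarrow> x \<in> S i"
    using sl ball_slice_nonempty by blast
  then obtain x where x: "\<And>i. i < n \<Longrightarrow> x i \<in> S i"
    by metis
  have C1: "norm c \<le> 1" if "c \<in> C" for c
  proof -
    from that obtain u where u: "\<forall>i<n. u i \<in> S i" and c: "c = (\<Sum>i<n. l i *\<^sub>R u i)"
      unfolding C_def by blast
    have "norm c \<le> (\<Sum>i<n. norm (l i *\<^sub>R u i))"
      unfolding c by (rule norm_sum)
    also have "\<dots> \<le> (\<Sum>i<n. l i)"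
      using u S l0 by (intro sum_mono) (auto intro: mult_left_le)
    finally show ?thesis
      using l1 by simp
  qed
  have bdd: "bounded C"
    using C1 by (auto simp: bounded_iff)
  have upper: "diameter C \<le> 2"
  proof (rule diameter_le)
    show "C \<noteq> {} \<or> 0 \<le> (2::real)" by simp
    show "norm (c - d) \<le> 2" if "c \<in> C" "d \<in> C" for c d
      using norm_triangle_ineq4[of c d] C1[OF that(1)] C1[OF that(2)] by linarith
  qed
  \<comment> \<open>Moving costs at most \<open>\<epsilon>\<close> in the value of
    \<open>f i\<close>, and rescaling divides by \<open>1 + \<epsilon>\<close>. The slice condition
    is strict, so all small \<open>\<epsilon>\<close> are admissible for all \<open>i < n\<close> at
    once.\<close>
  have "eventually (\<lambda>\<epsilon>. (blinfun_apply (f i) (x i) - \<epsilon>) / (1 + \<epsilon>) > b i) (at_right 0)" if "i < n" for i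
  proof (rule order_tendstoD)
    have "((\<lambda>\<epsilon>. (blinfun_apply (f i) (x i) - \<epsilon>) / (1 + \<epsilon>)) \<longlongrightarrow>
        (blinfun_apply (f i) (x i) - 0) / (1 + 0)) (at_right 0)"
      by (intro tendsto_intros) auto
    then show "((\<lambda>\<epsilon>. (blinfun_apply (f i) (x i) - \<epsilon>) / (1 + \<epsilon>)) \<longlongrightarrow>
        blinfun_apply (f i) (x i)) (at_right 0)"
      by simp
    show "b i < blinfun_apply (f i) (x i)"
      using x[OF that] S[OF that] by simp
  qed
  then have "eventually (\<lambda>\<epsilon>. \<forall>i\<in>{..<n}. (blinfun_apply (f i) (x i) - \<epsilon>) / (1 + \<epsilon>) > b i) (at_right 0)"
    by (intro eventually_ball_finite) auto
  moreover have "eventually (\<lambda>\<epsilon>::real. \<epsilon> > 0) (at_right 0)"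
    by (rule eventually_at_right_less)
  ultimately have ev: "eventually (\<lambda>\<epsilon>. 2 / (1 + \<epsilon>) \<le> diameter C) (at_right 0)"
  proof eventually_elim
    case (elim \<epsilon>)
    have A: "x ` {..<n} \<subseteq> cball 0 1"
      using x S by auto
    obtain z h where z: "norm z = 1"
      "\<And>u. u \<in> x ` {..<n} \<Longrightarrow> norm (u + z) \<le> 1 + \<epsilon>" "\<And>u. u \<in> x ` {..<n} \<Longrightarrow> norm (u - z) \<le> 1 + \<epsilon>"
      "\<And>g. g \<in> f ` {..<n} \<Longrightarrow> \<bar>blinfun_apply g z\<bar> \<le> \<epsilon>"
      using free_directionsE[OF free _ A _ elim(2), of "f ` {..<n}"] by (metis finite_imageI finite_lessThan)
    have mem: "(1 / (1 + \<epsilon>)) *\<^sub>R (x i + s *\<^sub>R z) \<in> S i" if "i < n" "s = 1 \<or> s = -1" for i s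
    proof -
      have "norm (x i + s *\<^sub>R z) \<le> 1 + \<epsilon>"
        using z(2,3)[of "x i"] that by auto
      then have "norm ((1 / (1 + \<epsilon>)) *\<^sub>R (x i + s *\<^sub>R z)) \<le> 1"
        using elim(2) by simp
      moreover have "blinfun_apply (f i) (x i) - \<epsilon> \<le> blinfun_apply (f i) (x i + s *\<^sub>R z)"
        using z(4)[of "f i"] that by (auto simp: blinfun.bilinear_simps abs_le_iff)
      then have "(blinfun_apply (f i) (x i) - \<epsilon>) / (1 + \<epsilon>) \<le> blinfun_apply (f i) (x i + s *\<^sub>R z) / (1 + \<epsilon>)"
        using elim(2) by (intro divide_right_mono) auto
      then have "b i < blinfun_apply (f i) ((1 / (1 + \<epsilon>)) *\<^sub>R (x i + s *\<^sub>R z))"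
        using elim(1) that(1) by (auto simp: blinfun.scaleR_right dest!: bspec[of _ _ i])
      ultimately show ?thesis
        using S[OF that(1)] by simp
    qed
    \<comment> \<open>In \<open>p 1 - p (-1)\<close> the \<open>x i\<close> cancel, and the weights
      have sum 1.\<close>
    define p where "p s = (\<Sum>i<n. l i *\<^sub>R (1 / (1 + \<epsilon>)) *\<^sub>R (x i + s *\<^sub>R z))" for s :: real
    have p: "p s \<in> C" if "s = 1 \<or> s = -1" for s
      unfolding C_def p_def using mem[OF _ that]
      by (intro CollectI exI[of _ "\<lambda>i. (1 / (1 + \<epsilon>)) *\<^sub>R (x i + s *\<^sub>R z)"]) simp
    have "p 1 - p (-1) = (\<Sum>i<n. l i *\<^sub>R (2 / (1 + \<epsilon>)) *\<^sub>R z)"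
      unfolding p_def sum_subtractf[symmetric]
      by (intro sum.cong refl)
         (simp add: scaleR_right_diff_distrib[symmetric] scaleR_left_distrib[symmetric] add_divide_distrib[symmetric]
           scaleR_2[symmetric])
    also have "\<dots> = (2 / (1 + \<epsilon>)) *\<^sub>R z"
      by (simp add: scaleR_left.sum[symmetric] sum_distrib_right[symmetric] sum_divide_distrib[symmetric] l1
          flip: scaleR_scaleR)
    finally have "dist (p 1) (p (-1)) = 2 / (1 + \<epsilon>)"
      using z(1) elim(2) by (simp add: dist_norm)
    then show ?case
      using diameter_bounded_bound[OF bdd p p, of 1 "-1"] by simp
  qed
  \<comment> \<open>The lower bounds \<open>2 / (1 + \<epsilon>)\<close> increase to 2 as
    \<open>\<epsilon>\<close> tends to 0.\<close>
  have "((\<lambda>\<epsilon>::real. 2 / (1 + \<epsilon>)) \<longlongrightarrow> 2 / (1 + 0)) (at_right 0)"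
    by (intro tendsto_intros) auto
  then have "2 / (1 + 0) \<le> diameter C"
    by (rule tendsto_upperbound) (use ev in auto)
  with upper show "diameter {(\<Sum>i<n. l i *\<^sub>R x i) | x. \<forall>i<n. x i \<in> S i} = 2"
    unfolding C_def by simp
qed

section \<open>Finite nets in finite-dimensional subspaces and octahedrality of the dual
  norm\<close>

text \<open>Induction on \<open>B\<close>: a new vector \<open>b\<close> has positive distance from
  the old span, which bounds the coefficient of \<open>b\<close> on the ball; the ball is then
  contained in a continuous image of a compact product.\<close>

lemma compact_span_Int_cball:
  fixes B :: "'a::real_normed_vector set"
  assumes "finite B"
  shows "compact (span B \<inter> cball 0 r)"
  using assms
proof (induction B arbitrary: r)
  case empty
  have "finite ({0::'a} \<inter> cball 0 r)" by simp
  then show ?case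
    unfolding span_empty by (rule finite_imp_compact)
next
  case (insert b B)
  show ?case
  proof (cases "b \<in> span B")
    case True
    then show ?thesis
      using insert.IH by (simp add: span_redundant)
  next
    case False
    define V where "V = span B"
    have V0: "0 \<in> V"
      by (simp add: V_def span_zero)
    \<comment> \<open>The induction hypothesis gives closedness only for bounded pieces of
      \<open>V\<close>, so the points approximating \<open>b\<close> are first confined to a
      ball.\<close>
    have "b \<notin> closure V"
    proof
      assume "b \<in> closure V"
      then have "b \<in> closure (V \<inter> cball 0 (norm b + 1))"
      proof -
        have "\<exists>y\<in>V \<inter> cball 0 (norm b + 1). dist y b < e" if "e > 0" for e
        proof -
          obtain y where y: "y \<in> V" "dist y b < min e 1"
            using \<open>b \<in> closure V\<close> \<open>e > 0\<close> unfolding closure_approachable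
            by (metis min_less_iff_conj zero_less_one)
          moreover have "norm y \<le> norm b + 1"
            using y(2) norm_triangle_sub[of y b] by (simp add: dist_norm)
          ultimately show ?thesis
            by auto
        qed
        then show ?thesis
          unfolding closure_approachable by blast
      qed
      moreover have "closed (V \<inter> cball 0 (norm b + 1))"
        using insert.IH unfolding V_def by (intro compact_imp_closed)
      ultimately show False
        using False by (simp add: V_def)
    qed
    then have "infdist b V \<noteq> 0"
      using V0 in_closure_iff_infdist_zero[of V b] by blast
    then have d: "infdist b V > 0"
      using infdist_nonneg[of b V] by linarith
    define d where "d = infdist b V"
    \<comment> \<open>The ranges are the bounds proved below: the coefficient of \<open>b\<close> is
      at most \<open>r / d\<close> in absolute value, which leaves a remainder in \<open>V\<close>
      of norm at most \<open>r + r / d * norm b\<close>.\<close>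
    define K where "K = (\<lambda>(c, v). c *\<^sub>R b + v) ` ({- (r / d)..r / d} \<times> (V \<inter> cball 0 (r + r / d * norm b)))"
    have "compact K"
      unfolding K_def
    proof (rule compact_continuous_image)
      show "continuous_on ({- (r / d)..r / d} \<times> (V \<inter> cball 0 (r + r / d * norm b))) (\<lambda>(c, v). c *\<^sub>R b + v)"
        unfolding split_beta by (intro continuous_intros)
      show "compact ({- (r / d)..r / d} \<times> (V \<inter> cball 0 (r + r / d * norm b)))"
        using insert.IH unfolding V_def by (intro compact_Times compact_Icc)
    qed
    moreover have "K \<subseteq> span (insert b B)"
      unfolding K_def V_def
      by (auto intro!: span_add span_scale span_base[of b] intro: subsetD[OF span_mono])
    moreover have "span (insert b B) \<inter> cball 0 r \<subseteq> K"
    proof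
      fix y
      assume y: "y \<in> span (insert b B) \<inter> cball 0 r"
      then obtain c where c: "y - c *\<^sub>R b \<in> V"
        unfolding V_def using span_breakdown_eq by blast
      have "\<bar>c\<bar> * d \<le> r"
      proof (cases "c = 0")
        case True
        then show ?thesis
          using y norm_ge_zero[of y] by (simp del: norm_ge_zero)
      next
        case False
        \<comment> \<open>Dividing \<open>y\<close> by \<open>c\<close> exhibits a point of
          \<open>V\<close> at distance \<open>norm y / \<bar>c\<bar>\<close> from \<open>b\<close>,
          and this distance is at least \<open>d\<close>.\<close>
        have "- (1 / c) *\<^sub>R (y - c *\<^sub>R b) \<in> V"
          using c unfolding V_def by (rule span_scale)
        then have "d \<le> dist b (- (1 / c) *\<^sub>R (y - c *\<^sub>R b))"
          unfolding d_def by (rule infdist_le)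
        also have "b - - (1 / c) *\<^sub>R (y - c *\<^sub>R b) = (1 / c) *\<^sub>R y"
          using False by (simp add: algebra_simps)
        then have "dist b (- (1 / c) *\<^sub>R (y - c *\<^sub>R b)) = norm y / \<bar>c\<bar>"
          by (simp add: dist_norm)
        finally show ?thesis
          using False y by (simp add: field_simps)
      qed
      then have c1: "\<bar>c\<bar> \<le> r / d"
        using d by (simp add: d_def field_simps)
      have "norm (y - c *\<^sub>R b) \<le> norm y + \<bar>c\<bar> * norm b"
        using norm_triangle_ineq4[of y "c *\<^sub>R b"] by simp
      also have "\<dots> \<le> r + r / d * norm b"
        using y c1 by (intro add_mono mult_right_mono) auto
      finally show "y \<in> K"
        unfolding K_def using c c1 by (intro image_eqI[of _ _ "(c, y - c *\<^sub>R b)"]) auto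
    qed
    \<comment> \<open>\<open>K\<close> may leave the ball but not the span, so cutting it back gives
      exactly the required set.\<close>
    ultimately have "span (insert b B) \<inter> cball 0 r = K \<inter> cball 0 r" "compact K"
      by blast+
    then show ?thesis
      by (simp add: compact_Int_closed)
  qed
qed

text \<open>Otherwise \<open>norm g - \<delta>\<close> would, by homogeneity, be an operator bound
  for \<open>g\<close> smaller than its norm.\<close>

lemma blinfun_nearly_attains_norm:
  fixes g :: "'a::real_normed_vector \<Rightarrow>\<^sub>L real"
  assumes "\<delta> > 0"
  obtains x where "norm x \<le> 1" "blinfun_apply g x \<ge> norm g - \<delta>"
proof (rule ccontr)
  assume "\<not> thesis"
  with that have *: "blinfun_apply g x < norm g - \<delta>" if "norm x \<le> 1" for x
    using \<open>norm x \<le> 1\<close> not_le by blast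
  from *[of 0] have pos: "norm g - \<delta> \<ge> 0"
    by simp
  have "norm (blinfun_apply g x) \<le> (norm g - \<delta>) * norm x" for x
  proof (cases "x = 0")
    case False
    \<comment> \<open>Both signs are needed to bound the absolute value.\<close>
    have "blinfun_apply g (s *\<^sub>R sgn x) < norm g - \<delta>" if "s = 1 \<or> s = -1" for s
      using that False by (intro *) (auto simp: norm_sgn)
    from this[of 1] this[of "-1"] have "\<bar>blinfun_apply g (sgn x)\<bar> \<le> norm g - \<delta>"
      by (auto simp: blinfun.bilinear_simps)
    then have "\<bar>blinfun_apply g x\<bar> / norm x \<le> norm g - \<delta>"
      using False by (simp add: sgn_div_norm blinfun.bilinear_simps abs_mult divide_inverse mult.commute)
    then show ?thesis
      using False by (simp add: field_simps)
  qed simp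
  then have "norm g \<le> norm g - \<delta>"
    using pos by (intro norm_blinfun_bound)
  with assms show False
    by simp
qed

text \<open>A finite net in the unit ball of \<open>Y\<close> reduces the claim to finitely many
  functionals, so a single pair \<open>z\<close>, \<open>f\<close> works for all of
  \<open>Y\<close>.\<close>

lemma octahedral_dual_if_free_directions:
  assumes free: "free_directions TYPE('a::real_normed_vector)"
  shows "octahedral_norm TYPE('a \<Rightarrow>\<^sub>L real)"
  unfolding octahedral_norm_def
proof (intro allI impI, elim conjE exE)
  fix \<epsilon> :: real and Y B :: "('a \<Rightarrow>\<^sub>L real) set"
  assume \<epsilon>: "\<epsilon> > 0" and Y: "subspace Y" and B: "finite B" "span B = Y"
  \<comment> \<open>The estimates below lose \<open>5 * \<delta>\<close>, and dividing by the norm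
    of the test vector, at most \<open>1 + \<delta>\<close>, costs one more
    \<open>\<delta>\<close>.\<close>
  define \<delta> where "\<delta> = min (\<epsilon> / 6) 1"
  have \<delta>: "\<delta> > 0" "\<delta> \<le> 1" "6 * \<delta> \<le> \<epsilon>"
    using \<epsilon> by (auto simp: \<delta>_def)
  obtain G where G: "finite G" "Y \<inter> cball 0 1 \<subseteq> (\<Union>g\<in>G. ball g \<delta>)"
    using compact_span_Int_cball[OF B(1), of 1] \<delta>(1) unfolding B(2) compact_eq_totally_bounded by blast
  have "\<forall>g::'a \<Rightarrow>\<^sub>L real. \<exists>x. norm x \<le> 1 \<and> blinfun_apply g x \<ge> norm g - \<delta>"
    using blinfun_nearly_attains_norm[OF \<delta>(1)] by metis
  then obtain x where x: "\<And>g::'a \<Rightarrow>\<^sub>L real. norm (x g) \<le> 1"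
      "\<And>g::'a \<Rightarrow>\<^sub>L real. blinfun_apply g (x g) \<ge> norm g - \<delta>"
    by metis
  obtain z f where z: "norm z = 1" "norm f = 1" "blinfun_apply f z = 1"
    "\<And>u. u \<in> x ` G \<Longrightarrow> \<bar>blinfun_apply f u\<bar> \<le> \<delta>"
    "\<And>u. u \<in> x ` G \<Longrightarrow> norm (u + z) \<le> 1 + \<delta>"
    "\<And>g. g \<in> G \<Longrightarrow> \<bar>blinfun_apply g z\<bar> \<le> \<delta>"
    using free_directionsE[OF free _ _ G(1) \<delta>(1), of "x ` G"] G(1) x(1)
    by (metis (no_types, lifting) finite_imageI image_subsetI mem_cball_0)
  \<comment> \<open>Unit vectors \<open>y\<close> come first: the test vector is
    \<open>x g + z\<close> for a net point \<open>g\<close> close to \<open>y\<close>.\<close>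
  have unit: "(1 - \<epsilon>) * (c + 1) \<le> norm (c *\<^sub>R f + y)" if c: "c \<ge> 0" and y: "y \<in> Y" "norm y = 1" for c y
  proof -
    obtain g where g: "g \<in> G" "norm (y - g) < \<delta>"
      using G(2) y by (auto simp: dist_norm norm_minus_commute)
    have gy: "norm g \<ge> 1 - \<delta>"
      using norm_triangle_ineq2[of y g] g(2) y(2) by linarith
    have "\<bar>blinfun_apply (y - g) (x g + z)\<bar> \<le> norm (y - g) * norm (x g + z)"
      by (rule abs_blinfun_le_norm)
    also have "\<dots> \<le> \<delta> * 2"
      using g(2) norm_triangle_ineq[of "x g" z] z(1) x(1)[of g] \<delta>(1) by (intro mult_mono) auto
    finally have "blinfun_apply y (x g + z) \<ge> blinfun_apply g (x g) + blinfun_apply g z - 2 * \<delta>"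
      by (simp add: blinfun.bilinear_simps)
    then have "blinfun_apply y (x g + z) \<ge> 1 - 5 * \<delta>"
      using x(2)[of g] gy z(6)[OF g(1)] by linarith
    \<comment> \<open>This is weaker than the available bound \<open>c * (1 - \<delta>)\<close>, but
      it has a factor in common with the estimate for \<open>y\<close>.\<close>
    moreover have "c * blinfun_apply f (x g + z) \<ge> c * (1 - 5 * \<delta>)"
      using c z(3) z(4)[of "x g"] g(1) \<delta>(1) by (intro mult_left_mono) (auto simp: blinfun.bilinear_simps)
    ultimately have "(1 - 5 * \<delta>) * (c + 1) \<le> blinfun_apply (c *\<^sub>R f + y) (x g + z)"
      by (simp add: blinfun.bilinear_simps algebra_simps)
    also have "\<dots> \<le> norm (c *\<^sub>R f + y) * norm (x g + z)"
      using abs_blinfun_le_norm[of "c *\<^sub>R f + y" "x g + z"] by linarith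
    also have "\<dots> \<le> norm (c *\<^sub>R f + y) * (1 + \<delta>)"
      using z(5)[of "x g"] g(1) by (intro mult_left_mono) auto
    finally have 1: "(1 - 5 * \<delta>) * (c + 1) \<le> norm (c *\<^sub>R f + y) * (1 + \<delta>)" .
    have "(1 - \<epsilon>) * (1 + \<delta>) \<le> (1 - 6 * \<delta>) * (1 + \<delta>)"
      using \<delta> by (intro mult_right_mono) auto
    also have "\<dots> \<le> 1 - 5 * \<delta>"
      using \<delta>(1) by (simp add: algebra_simps)
    finally have "(1 - \<epsilon>) * (1 + \<delta>) * (c + 1) \<le> (1 - 5 * \<delta>) * (c + 1)"
      using c by (intro mult_right_mono) auto
    with 1 have "((1 - \<epsilon>) * (c + 1)) * (1 + \<delta>) \<le> norm (c *\<^sub>R f + y) * (1 + \<delta>)"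
      by (simp add: mult_ac)
    then show ?thesis
      using \<delta>(1) by (simp add: mult_le_cancel_right)
  qed
  have nonneg: "(1 - \<epsilon>) * (c + norm y) \<le> norm (c *\<^sub>R f + y)" if c: "c \<ge> 0" and y: "y \<in> Y" for c y
  proof (cases "y = 0")
    case True
    then show ?thesis
      using c z(2) \<epsilon> by (simp add: mult_left_le_one_le algebra_simps)
  next
    case False
    \<comment> \<open>Scaling by \<open>1 / r\<close> reduces the claim to the unit case.\<close>
    define r where "r = norm y"
    have r: "r > 0"
      using False by (simp add: r_def)
    have "(1 - \<epsilon>) * (c / r + 1) \<le> norm ((c / r) *\<^sub>R f + (1 / r) *\<^sub>R y)"
      using c r y Y by (intro unit) (auto simp: subspace_scale r_def)
    also have "(c / r) *\<^sub>R f + (1 / r) *\<^sub>R y = (1 / r) *\<^sub>R (c *\<^sub>R f + y)"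
      by (simp add: scaleR_add_right)
    also have "norm \<dots> = norm (c *\<^sub>R f + y) / r"
      using r by simp
    also have "(1 - \<epsilon>) * (c / r + 1) = (1 - \<epsilon>) * (c + r) / r"
      using r by (simp add: field_simps)
    finally show ?thesis
      using r by (simp add: r_def[symmetric] divide_le_cancel)
  qed
  show "\<exists>x. norm x = 1 \<and> (\<forall>y\<in>Y. \<forall>c. (1 - \<epsilon>) * (\<bar>c\<bar> + norm y) \<le> norm (c *\<^sub>R x + y))"
  proof (intro exI[of _ f] conjI ballI allI)
    fix y and c :: real
    assume y: "y \<in> Y"
    show "(1 - \<epsilon>) * (\<bar>c\<bar> + norm y) \<le> norm (c *\<^sub>R f + y)"
    proof (cases "c \<ge> 0")
      case True
      then show ?thesis
        using nonneg[OF True y] by simp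
    next
      case False
      \<comment> \<open>\<open>Y\<close> is symmetric, so a negative \<open>c\<close> is handled by
        changing both signs.\<close>
      have "- c *\<^sub>R f + - y = - (c *\<^sub>R f + y)"
        by simp
      then have "norm (- c *\<^sub>R f + - y) = norm (c *\<^sub>R f + y)"
        by (metis norm_minus_cancel)
      then show ?thesis
        using nonneg[of "- c" "- y"] False y Y by (simp add: subspace_neg)
    qed
  qed (rule z(2))
qed

section \<open>Extending functionals to the completion\<close>

lemma Cauchy_blinfun_lim:
  fixes f :: "'a::real_normed_vector \<Rightarrow>\<^sub>L real"
  assumes "Cauchy x"
  shows "(\<lambda>n. blinfun_apply f (x n)) \<longlonglongrightarrow> lim (\<lambda>n. blinfun_apply f (x n))"
  using Cauchy_convergent[OF bounded_linear.Cauchy[OF blinfun.bounded_linear_right assms]]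
  by (simp add: convergent_LIMSEQ_iff)

text \<open>This is the extension by continuity; continuity at 0 makes the limit independent of the
  representing Cauchy sequence.\<close>

lift_definition completion_lim :: "('a::real_normed_vector \<Rightarrow>\<^sub>L real) \<Rightarrow> 'a completion \<Rightarrow> real"
  is "\<lambda>f x. lim (\<lambda>n. blinfun_apply f (x n))"
proof (clarify)
  fix f :: "'a \<Rightarrow>\<^sub>L real" and x y :: "nat \<Rightarrow> 'a"
  assume c: "Cauchy x" "Cauchy y" and l: "(\<lambda>n. x n - y n) \<longlonglongrightarrow> 0"
  have "(\<lambda>n. blinfun_apply f (y n)) \<longlonglongrightarrow> lim (\<lambda>n. blinfun_apply f (y n))"
    by (rule Cauchy_blinfun_lim[OF c(2)])
  moreover have "(\<lambda>n. blinfun_apply f (x n - y n)) \<longlonglongrightarrow> blinfun_apply f 0"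
    by (intro blinfun.tendsto tendsto_const l)
  ultimately have "(\<lambda>n. blinfun_apply f (x n - y n) + blinfun_apply f (y n)) \<longlonglongrightarrow>
      blinfun_apply f 0 + lim (\<lambda>n. blinfun_apply f (y n))"
    by (intro tendsto_add)
  then show "lim (\<lambda>n. blinfun_apply f (x n)) = lim (\<lambda>n. blinfun_apply f (y n))"
    by (simp add: blinfun.bilinear_simps limI)
qed

lemma completion_lim_embed: "completion_lim f (completion_embed a) = blinfun_apply f a"
  by transfer (simp add: limI)

lemma completion_lim_add: "completion_lim f (x + y) = completion_lim f x + completion_lim f y"
proof transfer
  fix f :: "'a \<Rightarrow>\<^sub>L real" and x y :: "nat \<Rightarrow> 'a"
  assume "Cauchy x \<and> Cauchy x \<and> (\<lambda>n. x n - x n) \<longlonglongrightarrow> 0"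
    and "Cauchy y \<and> Cauchy y \<and> (\<lambda>n. y n - y n) \<longlonglongrightarrow> 0"
  then have "Cauchy x" "Cauchy y" by auto
  from tendsto_add[OF this[THEN Cauchy_blinfun_lim, of f]]
  show "lim (\<lambda>n. blinfun_apply f (x n + y n))
      = lim (\<lambda>n. blinfun_apply f (x n)) + lim (\<lambda>n. blinfun_apply f (y n))"
    by (simp add: blinfun.bilinear_simps limI)
qed

lemma completion_lim_scaleR: "completion_lim f (c *\<^sub>R x) = c * completion_lim f x"
proof transfer
  fix f :: "'a \<Rightarrow>\<^sub>L real" and c :: real and x :: "nat \<Rightarrow> 'a"
  assume "Cauchy x \<and> Cauchy x \<and> (\<lambda>n. x n - x n) \<longlonglongrightarrow> 0"
  then have "Cauchy x" by auto
  from tendsto_mult[OF tendsto_const Cauchy_blinfun_lim[OF this, of f], of c]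
  show "lim (\<lambda>n. blinfun_apply f (c *\<^sub>R x n)) = c * lim (\<lambda>n. blinfun_apply f (x n))"
    by (simp add: blinfun.bilinear_simps limI)
qed

lemma abs_completion_lim_le: "\<bar>completion_lim f x\<bar> \<le> norm f * norm x"
proof -
  have "\<bar>completion_lim f x\<bar> \<le> K * norm x" if K: "\<And>a. \<bar>blinfun_apply f a\<bar> \<le> K * norm a" for K
    using K
  proof transfer
    fix f :: "'a \<Rightarrow>\<^sub>L real" and x :: "nat \<Rightarrow> 'a" and K :: real
    assume "Cauchy x \<and> Cauchy x \<and> (\<lambda>n. x n - x n) \<longlonglongrightarrow> 0"
    then have c: "Cauchy x" by auto
    assume K: "\<And>a. \<bar>blinfun_apply f a\<bar> \<le> K * norm a"
    have n: "(\<lambda>n. norm (x n)) \<longlonglongrightarrow> lim (\<lambda>n. norm (x n))"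
      using Cauchy_norm_convergent[OF c] by (simp add: convergent_LIMSEQ_iff)
    show "\<bar>lim (\<lambda>n. blinfun_apply f (x n))\<bar> \<le> K * lim (\<lambda>n. norm (x n))"
      by (rule LIMSEQ_le[OF tendsto_rabs[OF Cauchy_blinfun_lim[OF c]] tendsto_mult[OF tendsto_const n]])
         (use K in auto)
  qed
  moreover have "\<bar>blinfun_apply f a\<bar> \<le> norm f * norm a" for a
    using norm_blinfun[of f a] by simp
  ultimately show ?thesis
    by blast
qed

text \<open>This carries the functional on finitely supported functions over to the completion
  without increasing its norm.\<close>

lemma completion_blinfun_extension:
  fixes f :: "'a::real_normed_vector \<Rightarrow>\<^sub>L real"
  obtains g :: "'a completion \<Rightarrow>\<^sub>L real"
  where "\<And>a. blinfun_apply g (completion_embed a) = blinfun_apply f a" "norm g \<le> norm f"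
proof -
  have "bounded_linear (completion_lim f)"
    by (rule bounded_linear_intro[where K = "norm f"])
       (simp_all add: completion_lim_add completion_lim_scaleR abs_completion_lim_le mult.commute[of _ "norm f"])
  then have g: "blinfun_apply (Blinfun (completion_lim f)) = completion_lim f"
    by (rule bounded_linear_Blinfun_apply)
  show thesis
  proof (rule that)
    show "blinfun_apply (Blinfun (completion_lim f)) (completion_embed a) = blinfun_apply f a" for a
      by (simp add: g completion_lim_embed)
    show "norm (Blinfun (completion_lim f)) \<le> norm f"
      by (rule norm_blinfun_bound) (simp_all add: g abs_completion_lim_le)
  qed
qed

section \<open>Free directions in the tree space\<close>

lemma norm_tree_fun_leI:
  assumes "\<And>F. admissible F \<Longrightarrow> family_sum (Rep_tree_fun x) F \<le> c"
  shows "norm x \<le> c"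
  unfolding norm_tree_fun.rep_eq
  using assms admissible_empty by (intro cSUP_least) auto

lemma family_sum_le_norm: "admissible F \<Longrightarrow> family_sum (Rep_tree_fun x) F \<le> norm x"
  unfolding norm_tree_fun.rep_eq
  using Rep_tree_fun[of x] by (intro cSUP_upper bdd_above_family_sum) auto

lemma family_sum_add: "family_sum (\<lambda>t. x t + y t) F \<le> family_sum x F + family_sum y F"
  unfolding family_sum_def sum.distrib[symmetric]
  by (intro sum_mono) (simp add: sum.distrib abs_triangle_ineq)

text \<open>A segment is a chain of prefixes of \<open>s'\<close>, so it meets each level at most
  once.\<close>

lemma segment_unique_length:
  assumes "t \<in> segment s s'" "t' \<in> segment s s'" "length t = length t'"
  shows "t = t'"
proof -
  have "prefix t s'" "prefix t' s'"
    using assms(1,2) by (auto simp: segment_def)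
  then show ?thesis
    using assms(3) prefix_length_prefix[of t s' t'] by (auto intro: prefix_order.antisym simp: prefix_def)
qed

text \<open>A segment starting at or above the level of \<open>w\<close> reaches a child of \<open>w\<close> only through \<open>w\<close>,
  so at most one of a disjoint family does.\<close>

lemma family_sum_children_le:
  assumes F: "admissible F" "\<And>S. S \<in> F \<Longrightarrow> is_nm_segment n m S" and n: "n \<le> length w"
    and supp: "\<And>t. z t \<noteq> 0 \<Longrightarrow> \<exists>j. t = w @ [j]" and c: "\<And>t. \<bar>z t\<bar> \<le> c"
  shows "family_sum z F \<le> c"
proof -
  have fin: "finite F" and disj: "pairwise disjnt F"
    using F(1) by (auto simp: admissible_def)
  have c0: "c \<ge> 0"
    using c[of "[]"] by linarith
  have through: "w \<in> S \<and> \<bar>\<Sum>t\<in>S. z t\<bar> \<le> c" if S: "S \<in> F" "(\<Sum>t\<in>S. z t) \<noteq> 0" for S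
  proof -
    obtain s s' where s: "prefix s s'" "length s = n" "S = segment s s'"
      using F(2)[OF S(1)] by (auto simp: is_nm_segment_def)
    obtain t where t: "t \<in> S" "z t \<noteq> 0"
      using S(2) by (meson sum.neutral)
    then obtain j where j: "t = w @ [j]"
      using supp by blast
    have "prefix s (w @ [j])" "prefix (w @ [j]) s'"
      using t(1) s(3) j by (auto simp: segment_def)
    \<comment> \<open>As \<open>n \<le> length w\<close>, the segment cannot begin at the child
      itself, so its first node is a prefix of \<open>w\<close>.\<close>
    moreover have "s \<noteq> w @ [j]"
      using s(2) n by auto
    ultimately have "w \<in> S"
      unfolding s(3) segment_def by (auto intro: append_prefixD)
    moreover have "z u = 0" if "u \<in> S - {t}" for u
      using that supp[of u] segment_unique_length[of u s s' t] t(1) s(3) j by fastforce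
    then have "(\<Sum>u\<in>S. z u) = (\<Sum>u\<in>{t}. z u)"
      using t(1) s(3) by (intro sum.mono_neutral_right) (auto simp: finite_segment)
    ultimately show ?thesis
      using c[of t] by simp
  qed
  show ?thesis
  proof (cases "\<exists>S\<in>F. (\<Sum>t\<in>S. z t) \<noteq> 0")
    case True
    then obtain S where S: "S \<in> F" "(\<Sum>t\<in>S. z t) \<noteq> 0" by blast
    \<comment> \<open>A second segment with nonzero sum would also contain \<open>w\<close>, against
      disjointness.\<close>
    have "(\<Sum>t\<in>S'. z t) = 0" if "S' \<in> F - {S}" for S'
      using through[OF S] through[of S'] that disj S(1) by (auto simp: pairwise_def disjnt_def)
    then have "family_sum z F = (\<Sum>S\<in>{S}. \<bar>\<Sum>t\<in>S. z t\<bar>)"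
      unfolding family_sum_def using S(1) fin by (intro sum.mono_neutral_right) auto
    then show ?thesis
      using through[OF S] by simp
  next
    case False
    then show ?thesis
      using c0 by (simp add: family_sum_def)
  qed
qed

text \<open>The maximum reflects two cases for the starting level \<open>n\<close> of the family: if
  \<open>n > length w\<close>, the family misses \<open>x\<close>; otherwise it collects at most
  \<open>c\<close> from \<open>z\<close>.\<close>

lemma norm_add_children_le:
  assumes x: "\<And>t. length t > length w \<Longrightarrow> Rep_tree_fun x t = 0"
    and supp: "\<And>t. Rep_tree_fun z t \<noteq> 0 \<Longrightarrow> \<exists>j. t = w @ [j]" and c: "\<And>t. \<bar>Rep_tree_fun z t\<bar> \<le> c"
  shows "norm (x + z) \<le> max (norm z) (norm x + c)"
proof (rule norm_tree_fun_leI)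
  fix F
  assume F: "admissible F"
  then obtain n m where nm: "\<And>S. S \<in> F \<Longrightarrow> is_nm_segment n m S"
    by (auto simp: admissible_def)
  have "family_sum (Rep_tree_fun (x + z)) F \<le> family_sum (Rep_tree_fun x) F + family_sum (Rep_tree_fun z) F"
    using family_sum_add[of "Rep_tree_fun x" "Rep_tree_fun z"] by (simp add: plus_tree_fun.rep_eq)
  moreover have "family_sum (Rep_tree_fun z) F \<le> c" if "n \<le> length w"
    using F nm that supp c by (rule family_sum_children_le)
  moreover have "family_sum (Rep_tree_fun x) F = 0" if "n > length w"
  proof -
    have "Rep_tree_fun x t = 0" if "S \<in> F" "t \<in> S" for S t
    proof (rule x)
      obtain s s' where "length s = n" "S = segment s s'"
        using nm[OF \<open>S \<in> F\<close>] by (auto simp: is_nm_segment_def)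
      then show "length w < length t"
        using \<open>t \<in> S\<close> \<open>n > length w\<close> by (auto simp: segment_def dest: prefix_length_le)
    qed
    then show ?thesis
      by (simp add: family_sum_def)
  qed
  ultimately show "family_sum (Rep_tree_fun (x + z)) F \<le> max (norm z) (norm x + c)"
    using family_sum_le_norm[OF F, of x] family_sum_le_norm[OF F, of z]
    by (cases "n \<le> length w") auto
qed

lift_definition node_unit :: "nat list \<Rightarrow> tree_fun" is "\<lambda>s t. if t = s then 1 else 0"
  by simp

text \<open>Singletons at one level form an admissible family.\<close>

lemma sum_abs_level_le_norm:
  assumes "finite A" "\<And>t. t \<in> A \<Longrightarrow> length t = n"
  shows "(\<Sum>t\<in>A. \<bar>Rep_tree_fun x t\<bar>) \<le> norm x"
proof -
  have seg: "segment t t = {t}" for t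
    by (auto simp: segment_def)
  have "is_nm_segment n n {t}" if "t \<in> A" for t
    unfolding is_nm_segment_def using assms(2)[OF that] seg by blast
  then have "admissible ((\<lambda>t. {t}) ` A)"
    using assms(1) unfolding admissible_def by (auto simp: pairwise_def disjnt_def)
  from family_sum_le_norm[OF this, of x] show ?thesis
    unfolding family_sum_def by (subst (asm) sum.reindex) (auto simp: inj_on_def)
qed

lemma Rep_tree_fun_sum: "Rep_tree_fun (\<Sum>i\<in>I. x i) t = (\<Sum>i\<in>I. Rep_tree_fun (x i) t)"
  by (induction I rule: infinite_finite_induct) (simp_all add: zero_tree_fun.rep_eq plus_tree_fun.rep_eq)

lemma norm_node_unit: "norm (node_unit s) \<le> 1"
proof (rule norm_tree_fun_leI)
  fix F
  assume "admissible F"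
  then have "family_sum (Rep_tree_fun (node_unit s)) F \<le>
      (\<Sum>t\<in>{t. Rep_tree_fun (node_unit s) t \<noteq> 0}. \<bar>Rep_tree_fun (node_unit s) t\<bar>)"
    using Rep_tree_fun[of "node_unit s"] by (intro family_sum_le) auto
  then show "family_sum (Rep_tree_fun (node_unit s)) F \<le> 1"
    by (simp add: node_unit.rep_eq)
qed

section \<open>Pigeonhole selection and balanced signs\<close>

text \<open>The real line is cut into cells of length \<open>\<epsilon>\<close>. By boundedness the
  indices realise only finitely many patterns of cells, so some pattern occurs infinitely
  often.\<close>

lemma nearly_constant_infinite_subset:
  fixes a :: "'g \<Rightarrow> nat \<Rightarrow> real"
  assumes G: "finite G" and bdd: "\<And>g j. g \<in> G \<Longrightarrow> \<bar>a g j\<bar> \<le> b g" and \<epsilon>: "\<epsilon> > 0"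
  obtains I where "infinite I" "\<And>g i j. g \<in> G \<Longrightarrow> i \<in> I \<Longrightarrow> j \<in> I \<Longrightarrow> \<bar>a g i - a g j\<bar> \<le> \<epsilon>"
proof -
  \<comment> \<open>Restricting to \<open>G\<close> places the patterns in a finite product of
    integer intervals.\<close>
  define \<phi> where "\<phi> j = restrict (\<lambda>g. \<lfloor>a g j / \<epsilon>\<rfloor>) G" for j
  have "- b g / \<epsilon> \<le> a g j / \<epsilon>" "a g j / \<epsilon> \<le> b g / \<epsilon>" if "g \<in> G" for g j
    using bdd[OF that, of j] \<epsilon> by (intro divide_right_mono; linarith)+
  then have "range \<phi> \<subseteq> PiE G (\<lambda>g. {\<lfloor>- b g / \<epsilon>\<rfloor>..\<lfloor>b g / \<epsilon>\<rfloor>})"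
    unfolding \<phi>_def by (auto intro!: floor_mono)
  then have "finite (range \<phi>)"
    using G by (rule finite_subset[OF _ finite_PiE]) auto
  then obtain j0 where inf: "infinite {j. \<phi> j = \<phi> j0}"
    using pigeonhole_infinite[of UNIV \<phi>] by auto
  have "\<bar>a g i - a g j\<bar> \<le> \<epsilon>" if g: "g \<in> G" and "\<phi> i = \<phi> j0" "\<phi> j = \<phi> j0" for g i j
  proof -
    have "\<phi> i g = \<phi> j g"
      using that by simp
    then have "\<lfloor>a g i / \<epsilon>\<rfloor> = \<lfloor>a g j / \<epsilon>\<rfloor>"
      using g by (simp add: \<phi>_def)
    then have "\<bar>a g i / \<epsilon> - a g j / \<epsilon>\<bar> \<le> 1"
      by linarith
    then show ?thesis
      using \<epsilon> by (simp add: diff_divide_distrib[symmetric] abs_divide)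
  qed
  with inf that show thesis
    by blast
qed

lemma infinite_balanced_signs:
  assumes "infinite (I :: 'i set)"
  obtains A and \<sigma> :: "'i \<Rightarrow> real"
  where "A \<subseteq> I" "finite A" "card A = 2 * k" "\<And>j. \<bar>\<sigma> j\<bar> = 1" "(\<Sum>j\<in>A. \<sigma> j) = 0"
proof -
  obtain P where P: "P \<subseteq> I" "finite P" "card P = k"
    using infinite_arbitrarily_large[OF assms] by blast
  obtain Q where Q: "Q \<subseteq> I - P" "finite Q" "card Q = k"
    using infinite_arbitrarily_large[OF Diff_infinite_finite[OF P(2) assms]] by blast
  \<comment> \<open>The value -1 is used everywhere off \<open>P\<close>, so that the modulus is 1
    at every index.\<close>
  define \<sigma> :: "'i \<Rightarrow> real" where "\<sigma> j = (if j \<in> P then 1 else -1)" for j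
  have "(\<Sum>j\<in>P \<union> Q. \<sigma> j) = (\<Sum>j\<in>P. \<sigma> j) + (\<Sum>j\<in>Q. \<sigma> j)"
    using P Q by (intro sum.union_disjoint) auto
  also have "(\<Sum>j\<in>P. \<sigma> j) = (\<Sum>j\<in>P. 1)"
    by (intro sum.cong) (auto simp: \<sigma>_def)
  also have "(\<Sum>j\<in>Q. \<sigma> j) = (\<Sum>j\<in>Q. -1)"
    using Q by (intro sum.cong) (auto simp: \<sigma>_def)
  finally have "(\<Sum>j\<in>P \<union> Q. \<sigma> j) = 0"
    using P Q by simp
  moreover have "card (P \<union> Q) = 2 * k"
    using P Q by (subst card_Un_disjoint) auto
  ultimately show thesis
    using P Q by (intro that[of "P \<union> Q" \<sigma>]) (auto simp: \<sigma>_def)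
qed

text \<open>Signs with sum 0 allow a fixed value \<open>a i\<close> to be subtracted from every
  \<open>a j\<close>, which leaves an average of terms of modulus at most
  \<open>\<epsilon>\<close>.\<close>

lemma abs_balanced_average_le:
  fixes \<sigma> a :: "'i \<Rightarrow> real"
  assumes "finite A" "\<And>j. \<bar>\<sigma> j\<bar> = 1" "(\<Sum>j\<in>A. \<sigma> j) = 0"
    and a: "\<And>i j. i \<in> A \<Longrightarrow> j \<in> A \<Longrightarrow> \<bar>a i - a j\<bar> \<le> \<epsilon>" and "\<epsilon> \<ge> 0"
  shows "\<bar>(\<Sum>j\<in>A. \<sigma> j / card A * a j)\<bar> \<le> \<epsilon>"
proof (cases "A = {}")
  case True
  then show ?thesis using assms by simp
next
  case False
  then obtain i where i: "i \<in> A" by blast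
  have "(\<Sum>j\<in>A. \<sigma> j / card A * a j) = (\<Sum>j\<in>A. \<sigma> j / card A * (a j - a i)) + (\<Sum>j\<in>A. \<sigma> j) / card A * a i"
    by (simp add: right_diff_distrib sum_subtractf sum_distrib_right sum_divide_distrib)
  also have "\<dots> = (\<Sum>j\<in>A. \<sigma> j / card A * (a j - a i))"
    using assms(3) by simp
  also have "\<bar>\<dots>\<bar> \<le> (\<Sum>j\<in>A. \<bar>\<sigma> j / card A * (a j - a i)\<bar>)"
    by (rule sum_abs)
  also have "\<dots> \<le> (\<Sum>j\<in>A. 1 / card A * \<epsilon>)"
    using assms(2) a[OF _ i] by (intro sum_mono) (simp add: abs_mult abs_divide divide_right_mono)
  also have "\<dots> = \<epsilon>"
    using assms(1) False by simp
  finally show ?thesis .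
qed

section \<open>The signed average over children and its norming functional\<close>

definition signed_children :: "nat list \<Rightarrow> nat set \<Rightarrow> (nat \<Rightarrow> real) \<Rightarrow> tree_fun" where
  "signed_children w A \<sigma> = (\<Sum>j\<in>A. (\<sigma> j / card A) *\<^sub>R node_unit (w @ [j]))"

text \<open>The last entry of a child \<open>t = w @ [j]\<close> is its index \<open>j\<close>, so
  \<open>\<sigma> (last t)\<close> is the sign placed there.\<close>

lemma Rep_signed_children:
  assumes "finite A"
  shows "Rep_tree_fun (signed_children w A \<sigma>) t =
    (if \<exists>j\<in>A. t = w @ [j] then \<sigma> (last t) / card A else 0)"
proof -
  have "Rep_tree_fun (signed_children w A \<sigma>) t = (\<Sum>j\<in>A. if t = w @ [j] then \<sigma> (last t) / card A else 0)"
    unfolding signed_children_def Rep_tree_fun_sum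
    by (intro sum.cong) (auto simp: scaleR_tree_fun.rep_eq node_unit.rep_eq)
  also have "\<dots> = (if \<exists>j\<in>A. t = w @ [j] then \<sigma> (last t) / card A else 0)"
  proof (cases "\<exists>j\<in>A. t = w @ [j]")
    case True
    then obtain j where "j \<in> A" "t = w @ [j]" by blast
    with assms show ?thesis by (simp add: sum.delta eq_commute)
  next
    case False
    then show ?thesis by (auto intro!: sum.neutral)
  qed
  finally show ?thesis .
qed

lemma norm_signed_children_le:
  assumes "\<And>j. \<bar>\<sigma> j\<bar> = 1"
  shows "norm (signed_children w A \<sigma>) \<le> 1"
proof -
  have "norm (signed_children w A \<sigma>) \<le> (\<Sum>j\<in>A. norm ((\<sigma> j / card A) *\<^sub>R node_unit (w @ [j])))"
    unfolding signed_children_def by (rule norm_sum)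
  also have "\<dots> \<le> (\<Sum>j\<in>A. 1 / card A)"
    using assms by (intro sum_mono) (simp add: abs_divide divide_right_mono norm_node_unit)
  also have "\<dots> \<le> 1"
    by simp
  finally show ?thesis .
qed

text \<open>The children of \<open>w\<close> lie on one level, so the norm dominates the sum of the
  moduli over them.\<close>

lemma signed_children_functional:
  assumes A: "finite A" and \<sigma>: "\<And>j. \<bar>\<sigma> j\<bar> = (1::real)"
  obtains f :: "tree_fun \<Rightarrow>\<^sub>L real"
  where "norm f \<le> 1" "\<And>x. blinfun_apply f x = (\<Sum>j\<in>A. \<sigma> j * Rep_tree_fun x (w @ [j]))"
proof -
  define h where "h x = (\<Sum>j\<in>A. \<sigma> j * Rep_tree_fun x (w @ [j]))" for x
  have h: "\<bar>h x\<bar> \<le> norm x" for x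
  proof -
    have "\<bar>h x\<bar> \<le> (\<Sum>j\<in>A. \<bar>\<sigma> j * Rep_tree_fun x (w @ [j])\<bar>)"
      unfolding h_def by (rule sum_abs)
    also have "\<dots> = (\<Sum>t\<in>(\<lambda>j. w @ [j]) ` A. \<bar>Rep_tree_fun x t\<bar>)"
      by (subst sum.reindex) (auto simp: inj_on_def abs_mult \<sigma>)
    also have "\<dots> \<le> norm x"
      using A by (intro sum_abs_level_le_norm[of _ "Suc (length w)"]) auto
    finally show ?thesis .
  qed
  have "bounded_linear h"
    by (rule bounded_linear_intro[where K = 1])
       (use h in \<open>auto simp: h_def plus_tree_fun.rep_eq scaleR_tree_fun.rep_eq
          sum.distrib sum_distrib_left algebra_simps\<close>)
  then have "blinfun_apply (Blinfun h) = h"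
    by (rule bounded_linear_Blinfun_apply)
  then show thesis
    using h by (intro that[of "Blinfun h"] norm_blinfun_bound) (simp_all add: h_def)
qed

section \<open>Construction of the free directions in the completion\<close>

lemma free_directions_JH_infty: "free_directions TYPE(JH_infty)"
  unfolding free_directions_def
proof (intro allI impI, elim conjE)
  fix X :: "JH_infty set" and G :: "(JH_infty \<Rightarrow>\<^sub>L real) set" and \<epsilon> :: real
  assume X: "finite X" "X \<subseteq> cball 0 1" and G: "finite G" and \<epsilon>: "\<epsilon> > 0"
  \<comment> \<open>Three errors occur: replacing \<open>x\<close> by the finitely supported
    \<open>a x\<close>, the excess of \<open>norm (a x)\<close> over 1, and the size of the
    coefficients of \<open>z\<close>.\<close>
  define \<delta> where "\<delta> = \<epsilon> / 3"
  have \<delta>: "\<delta> > 0"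
    using \<epsilon> by (simp add: \<delta>_def)
  obtain a where a: "\<And>x::JH_infty. norm (x - completion_embed (a x)) < \<delta>"
    using completion_embed_dense[OF \<delta>] by metis
  have norm_a: "norm (a x) \<le> 1 + \<delta>" if "x \<in> X" for x
    using norm_triangle_ineq2[of "completion_embed (a x)" x] a[of x] X(2) that
    by (auto simp: norm_completion_embed norm_minus_commute)
  have "finite (\<Union>x\<in>X. {t. Rep_tree_fun (a x) t \<noteq> 0})"
    using X(1) Rep_tree_fun by blast
  then have "finite (length ` (\<Union>x\<in>X. {t. Rep_tree_fun (a x) t \<noteq> 0}))"
    by (rule finite_imageI)
  then obtain N where "\<forall>n\<in>length ` (\<Union>x\<in>X. {t. Rep_tree_fun (a x) t \<noteq> 0}). n \<le> N"
    unfolding finite_nat_set_iff_bounded_le by (rule exE)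
  then have N: "length t \<le> N" if "x \<in> X" "Rep_tree_fun (a x) t \<noteq> 0" for x t
    using that by blast
  \<comment> \<open>The supports of all \<open>a x\<close> reach at most level \<open>N\<close>, so
    the children of a node at level \<open>N\<close> lie below them.\<close>
  define w where "w = replicate N (0::nat)"
  have w: "Rep_tree_fun (a x) t = 0" if "x \<in> X" "length t > length w" for x t
    using N[OF that(1), of t] that(2) by (force simp: w_def)
  have "\<bar>blinfun_apply g (completion_embed (node_unit (w @ [j])))\<bar> \<le> norm g" for g :: "JH_infty \<Rightarrow>\<^sub>L real" and j
  proof -
    have "\<bar>blinfun_apply g (completion_embed (node_unit (w @ [j])))\<bar> \<le> norm g * norm (node_unit (w @ [j]))"
      using norm_blinfun[of g "completion_embed (node_unit (w @ [j]))"] by (simp add: norm_completion_embed)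
    also have "\<dots> \<le> norm g"
      using norm_node_unit by (intro mult_left_le) auto
    finally show ?thesis .
  qed
  then obtain I where I: "infinite I"
    "\<And>g i j. g \<in> G \<Longrightarrow> i \<in> I \<Longrightarrow> j \<in> I \<Longrightarrow>
      \<bar>blinfun_apply g (completion_embed (node_unit (w @ [i]))) -
        blinfun_apply g (completion_embed (node_unit (w @ [j])))\<bar> \<le> \<epsilon>"
    using nearly_constant_infinite_subset[OF G _ \<epsilon>,
        of "\<lambda>g j. blinfun_apply g (completion_embed (node_unit (w @ [j])))" norm] by metis
  \<comment> \<open>The coefficients of \<open>z\<close> have modulus
    \<open>1 / (2 * Suc k)\<close>; the successor keeps \<open>A\<close> nonempty.\<close>
  obtain k where k: "1 / real (Suc k) < \<delta>"
    using \<delta> reals_Archimedean[of \<delta>] by (auto simp: inverse_eq_divide)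
  obtain A and \<sigma> :: "nat \<Rightarrow> real" where A: "A \<subseteq> I" "finite A" "card A = 2 * Suc k"
    and \<sigma>: "\<And>j. \<bar>\<sigma> j\<bar> = 1" "(\<Sum>j\<in>A. \<sigma> j) = 0"
    using infinite_balanced_signs[OF I(1)] by metis
  define z where "z = signed_children w A \<sigma>"
  have z_rep: "Rep_tree_fun z t = (if \<exists>j\<in>A. t = w @ [j] then \<sigma> (last t) / card A else 0)" for t
    unfolding z_def by (rule Rep_signed_children[OF A(2)])
  have "1 / real (card A) \<le> 1 / real (Suc k)"
    unfolding A(3) by (intro divide_left_mono) auto
  then have z_abs: "\<bar>Rep_tree_fun z t\<bar> \<le> \<delta>" for t
    using k \<delta> by (simp add: z_rep \<sigma> abs_divide)
  have z_supp: "\<exists>j. t = w @ [j]" if "Rep_tree_fun z t \<noteq> 0" for t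
    using that by (auto simp: z_rep split: if_splits)
  have z1: "norm z \<le> 1"
    unfolding z_def by (rule norm_signed_children_le[OF \<sigma>(1)])
  obtain f where f: "norm f \<le> 1"
    "\<And>x. blinfun_apply f x = (\<Sum>j\<in>A. \<sigma> j * Rep_tree_fun x (w @ [j]))"
    using signed_children_functional[where \<sigma> = \<sigma> and w = w, OF A(2) \<sigma>(1)] by blast
  obtain h :: "JH_infty \<Rightarrow>\<^sub>L real" where h: "\<And>a. blinfun_apply h (completion_embed a) = blinfun_apply f a"
    "norm h \<le> norm f"
    using completion_blinfun_extension[of f] by blast
  have near: "norm (x + completion_embed u) \<le> 1 + \<epsilon>"
    if "x \<in> X" "norm (a x + u) \<le> 1 + 2 * \<delta>" for x u
  proof -
    have "x + completion_embed u = (x - completion_embed (a x)) + completion_embed (a x + u)"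
      by (simp add: linear_add[OF linear_completion_embed])
    then have "norm (x + completion_embed u) \<le> norm (x - completion_embed (a x)) + norm (completion_embed (a x + u))"
      by (metis norm_triangle_ineq)
    then show ?thesis
      using a[of x] that(2) by (simp add: norm_completion_embed \<delta>_def)
  qed
  define Z where "Z = completion_embed z"
  have Z1: "norm Z \<le> 1"
    using z1 by (simp add: Z_def norm_completion_embed)
  have h1: "norm h \<le> 1"
    using h(2) f(1) by linarith
  have "\<sigma> j * \<sigma> j = 1" for j
    using abs_mult_self_eq[of "\<sigma> j"] unfolding \<sigma>(1) by simp
  then have "blinfun_apply f z = (\<Sum>j\<in>A. 1 / card A)"
    unfolding f(2) by (intro sum.cong refl) (simp add: z_rep)
  also have "\<dots> = 1"
    using A(3) by simp
  finally have hZ: "blinfun_apply h Z = 1"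
    by (simp add: Z_def h(1))
  \<comment> \<open>Both norms are at most 1 and their product is at least 1, so both equal
    1.\<close>
  have "1 \<le> norm h * norm Z"
    using norm_blinfun[of h Z] hZ by simp
  moreover have "norm h * norm Z \<le> norm h" "norm h * norm Z \<le> norm Z"
    using Z1 h1 by (simp_all add: mult_left_le mult_left_le_one_le)
  ultimately have "norm Z = 1" "norm h = 1"
    using Z1 h1 by linarith+
  moreover have "\<bar>blinfun_apply h x\<bar> \<le> \<epsilon>" if "x \<in> X" for x
  proof -
    \<comment> \<open>The functional reads only values at children of \<open>w\<close>, where
      \<open>a x\<close> vanishes, so only the approximation error remains.\<close>
    have "blinfun_apply h (completion_embed (a x)) = 0"
      unfolding h(1) f(2) using w[OF that] by (simp add: sum.neutral)
    then have "\<bar>blinfun_apply h x\<bar> = \<bar>blinfun_apply h (x - completion_embed (a x))\<bar>"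
      by (simp add: blinfun.diff_right)
    also have "\<dots> \<le> norm h * norm (x - completion_embed (a x))"
      using norm_blinfun[of h] by simp
    also have "\<dots> \<le> norm (x - completion_embed (a x))"
      using h1 by (simp add: mult_left_le_one_le)
    finally show ?thesis
      using a[of x] \<delta> by (simp add: \<delta>_def)
  qed
  moreover have "norm (x + Z) \<le> 1 + \<epsilon>" if "x \<in> X" for x
    unfolding Z_def
  proof (rule near[OF that])
    have "norm (a x + z) \<le> max (norm z) (norm (a x) + \<delta>)"
      using w[OF that] z_supp z_abs by (rule norm_add_children_le)
    then show "norm (a x + z) \<le> 1 + 2 * \<delta>"
      using norm_a[OF that] z1 \<delta> by linarith
  qed
  moreover have "norm (x - Z) \<le> 1 + \<epsilon>" if "x \<in> X" for x
  proof -
    \<comment> \<open>The support and coefficient bounds for \<open>z\<close> hold for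
      \<open>- z\<close> as well.\<close>
    have "norm (a x + - z) \<le> max (norm (- z)) (norm (a x) + \<delta>)"
      using z_supp z_abs by (intro norm_add_children_le w[OF that]) (simp_all add: uminus_tree_fun.rep_eq)
    then have "norm (a x + - z) \<le> 1 + 2 * \<delta>"
      using norm_a[OF that] z1 \<delta> unfolding norm_minus_cancel by linarith
    then have "norm (x + completion_embed (- z)) \<le> 1 + \<epsilon>"
      by (rule near[OF that])
    then show ?thesis
      by (simp add: Z_def linear_neg[OF linear_completion_embed])
  qed
  moreover have "\<bar>blinfun_apply g Z\<bar> \<le> \<epsilon>" if g: "g \<in> G" for g
  proof -
    have "blinfun_apply g Z = (\<Sum>j\<in>A. \<sigma> j / card A * blinfun_apply g (completion_embed (node_unit (w @ [j]))))"
      by (simp add: Z_def z_def signed_children_def linear_sum[OF linear_completion_embed]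
          linear_scale[OF linear_completion_embed] blinfun.sum_right blinfun.scaleR_right)
    then show ?thesis
      using A(1) I(2)[OF g] \<epsilon> by (simp only:) (intro abs_balanced_average_le A(2) \<sigma>, auto)
  qed
  ultimately show "\<exists>z f. norm z = 1 \<and> norm f = 1 \<and> blinfun_apply f z = 1 \<and>
        (\<forall>x\<in>X. \<bar>blinfun_apply f x\<bar> \<le> \<epsilon> \<and> norm (x + z) \<le> 1 + \<epsilon> \<and> norm (x - z) \<le> 1 + \<epsilon>) \<and>
        (\<forall>g\<in>G. \<bar>blinfun_apply g z\<bar> \<le> \<epsilon>)"
    using hZ by blast
qed

theorem theorem4p1:
  shows "strong_diameter_two TYPE(JH_infty) \<and> octahedral_norm TYPE(JH_infty \<Rightarrow>\<^sub>L real)"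
  using strong_diameter_two_if_free_directions octahedral_dual_if_free_directions
    free_directions_JH_infty by blast

end
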